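(* Let $\Gamma$ be a group generated by the finite symmetric set $S$. Let $(\Gamma_{n})$ be a chain of finite index subgroups in $\Gamma$ and let $$\rho^{+}=\sup_n\rho^{+}(\mathrm{Sch}(\Gamma/\Gamma_{n},S)),$$ where $\mathrm{Sch}(\Gamma/\Gamma_{n},S)$ is the Schreier graph of the coset action on $\Gamma/\Gamma_{n}$. If $H\leq\Gamma$ is a subgroup such that $$\rho(\Gamma,H,\lambda_{S})>\rho^{+}$$ then there exists a finitely generated subgroup $H'\leq H$ such that $(H'\cap\Gamma_{n})$ has property $(\tau)$ in $H'$; if moreover the $\Gamma_{n}$ are normal in $\Gamma$, then there exists $M>0$ such that $|\Gamma:H'\Gamma_{n}|<M$ for all $n$.
   Context: A chain is a decreasing sequence $\Gamma_0\ge\Gamma_1\ge\cdots$ of subgroups of $\Gamma$. A finite set $S$ is symmetric if $S=S^{-1}$, and $\lambda_S$ is the uniform probability measure on $S$. $\mathrm{Sch}(\Gamma/\Gamma_n,S)$ is the $|S|$-regular (multi)graph on the coset space $\Gamma/\Gamma_n$ in which each vertex is joined to its images under the elements of $S$ (loops and multiple edges allowed). For a finite $d$-regular graph $G$, $\rho^+(G)$ denotes the largest nontrivial eigenvalue of the Markov (random walk) operator on $G$, i.e. its largest eigenvalue on the space of functions on the vertices with zero sum. For a subgroup $H\le\Gamma$ and a symmetric probability measure $\lambda$ on $\Gamma$, let $H\backslash\Gamma$ be the set of right cosets $Hg$, let $M_\lambda$ act on $l^2(H\backslash\Gamma)$ by $(fM_\lambda)(Hg)=\sum_{s\in\Gamma}\lambda(s)f(Hgs)$,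 and define the relative spectral radius $$\rho(\Gamma,H,\lambda)=\sup_{0\neq f\in l^{2}(H\backslash\Gamma)}\frac{\langle fM_{\lambda},f\rangle}{\langle f,f\rangle}$$ (which equals $\|M_\lambda\|$ and $\lim_{n}\sqrt[2n]{p_{e,H,2n}}$, where $p_{e,H,n}$ is the probability that the $\lambda$-random walk on $\Gamma$ of length $n$ starting at $e$ ends in $H$). A sequence $(\Delta_n)$ of finite index subgroups of a finitely generated group $\Delta$ has property $(\tau)$ in $\Delta$ if for a finite symmetric generating set $T$ of $\Delta$ we have $\sup_n\rho^+(\mathrm{Sch}(\Delta/\Delta_n,T))<1$ (this does not depend on $T$). *)

theory Defs
  imports
    "HOL-Algebra.Left_Coset"
    "HOL-Algebra.Generated_Groups"
    "HOL-Probability.Probability_Mass_Function"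
    "Graph_Theory.Digraph"
begin

definition finite_index_subgroup :: "'a set \<Rightarrow> ('a, 'b) monoid_scheme \<Rightarrow> bool" where
  "finite_index_subgroup K G \<longleftrightarrow> subgroup K G \<and> finite (rcosets\<^bsub>G\<^esub> K)"

definition symmetric_generating_set :: "'a set \<Rightarrow> ('a, 'b) monoid_scheme \<Rightarrow> bool" where
  "symmetric_generating_set S G \<longleftrightarrow>
     finite S \<and> S \<subseteq> carrier G \<and> set_inv\<^bsub>G\<^esub> S = S \<and> generate G S = carrier G"

definition finitely_generated_subgroup :: "'a set \<Rightarrow> ('a, 'b) monoid_scheme \<Rightarrow> bool" where
  "finitely_generated_subgroup K G \<longleftrightarrow>
     subgroup K G \<and> (\<exists>T. finite T \<and> T \<subseteq> K \<and> generate G T = K)"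

text \<open>The Schreier graph has one arc, labelled by \<open>(X, s)\<close>, from the left coset \<open>X\<close> to \<open>sX\<close>
  for each \<open>s\<close> in \<open>S\<close>, so loops and multiple edges are kept. For symmetric \<open>S\<close> the arcs
  \<open>(X, s)\<close> and \<open>(sX, inv s)\<close> are the two directions of an undirected edge.\<close>

definition schreier_graph ::
  "('a, 'b) monoid_scheme \<Rightarrow> 'a set \<Rightarrow> 'a set \<Rightarrow> ('a set, 'a set \<times> 'a) pre_digraph" where
  "schreier_graph G K S =
     \<lparr>verts = lcosets\<^bsub>G\<^esub> K, arcs = (lcosets\<^bsub>G\<^esub> K) \<times> S, tail = fst,
      head = (\<lambda>(X, s). s <#\<^bsub>G\<^esub> X)\<rparr>"

definition markov_operator :: "('v, 'e) pre_digraph \<Rightarrow> ('v \<Rightarrow> real) \<Rightarrow> 'v \<Rightarrow> real" where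
  "markov_operator D f v = (\<Sum>e\<in>out_arcs D v. f (head D e)) / real (out_degree D v)"

definition nontrivial_eigenvalue :: "('v, 'e) pre_digraph \<Rightarrow> real \<Rightarrow> bool" where
  "nontrivial_eigenvalue D \<mu> \<longleftrightarrow>
     (\<exists>f. (\<exists>v\<in>verts D. f v \<noteq> 0) \<and> (\<Sum>v\<in>verts D. f v) = 0 \<and>
          (\<forall>v\<in>verts D. markov_operator D f v = \<mu> * f v))"

text \<open>The supremum is a maximum as soon as the graph is finite with at least two vertices. A
  one-vertex graph has no nontrivial eigenvalue, and its \<open>rho_plus\<close> is \<open>-\<infinity>\<close>; it therefore does
  not contribute to a supremum over a sequence of graphs.\<close>

definition rho_plus :: "('v, 'e) pre_digraph \<Rightarrow> ereal" where
  "rho_plus D = Sup (ereal ` {\<mu>. nontrivial_eigenvalue D \<mu>})"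

definition l2_cosets :: "('a, 'b) monoid_scheme \<Rightarrow> 'a set \<Rightarrow> ('a set \<Rightarrow> real) set" where
  "l2_cosets G H = {f. (\<lambda>X. (f X)\<^sup>2) summable_on (rcosets\<^bsub>G\<^esub> H)}"

definition inner_cosets ::
  "('a, 'b) monoid_scheme \<Rightarrow> 'a set \<Rightarrow> ('a set \<Rightarrow> real) \<Rightarrow> ('a set \<Rightarrow> real) \<Rightarrow> real" where
  "inner_cosets G H f g = (\<Sum>\<^sub>\<infinity>X\<in>rcosets\<^bsub>G\<^esub> H. f X * g X)"

definition coset_walk_operator ::
  "('a, 'b) monoid_scheme \<Rightarrow> 'a pmf \<Rightarrow> ('a set \<Rightarrow> real) \<Rightarrow> 'a set \<Rightarrow> real" where
  "coset_walk_operator G p f X = (\<Sum>\<^sub>\<infinity>s\<in>carrier G. pmf p s * f (X #>\<^bsub>G\<^esub> s))"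

definition relative_spectral_radius ::
  "('a, 'b) monoid_scheme \<Rightarrow> 'a set \<Rightarrow> 'a pmf \<Rightarrow> ereal" where
  "relative_spectral_radius G H p =
     (SUP f \<in> {f \<in> l2_cosets G H. \<exists>X\<in>rcosets\<^bsub>G\<^esub> H. f X \<noteq> 0}.
        ereal (inner_cosets G H (coset_walk_operator G p f) f / inner_cosets G H f f))"

definition property_tau :: "('a, 'b) monoid_scheme \<Rightarrow> (nat \<Rightarrow> 'a set) \<Rightarrow> bool" where
  "property_tau G K \<longleftrightarrow>
     (\<forall>n. finite_index_subgroup (K n) G) \<and>
     (\<exists>T. symmetric_generating_set T G \<and> (SUP n. rho_plus (schreier_graph G (K n) T)) < 1)"

end

theory Submission
  imports Defs "HOL-Algebra.Zassenhaus"
begin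

text \<open>
  Choose \<open>r\<close> strictly between the supremum of the \<open>rho_plus\<close> and the relative spectral radius, and a
  finitely supported \<open>f\<close> on the right cosets of \<open>H\<close> whose Rayleigh quotient exceeds \<open>r\<close>. If \<open>\<phi>\<close> is a
  function on \<open>G/K n\<close> that is (almost) invariant under the finitely many elements of \<open>H\<close> relating the
  support of \<open>f\<close> to its \<open>S\<close>-translates, then \<open>\<Theta>(z)\<^sup>2 = (\<Sum>Hg. f(Hg)\<^sup>2 \<phi>(g z)\<^sup>2)\<close> defines a function on \<open>G/K n\<close>
  whose Rayleigh quotient exceeds \<open>r\<close> by Cauchy-Schwarz. As \<open>r\<close> bounds the quadratic form on
  functions of zero sum, \<open>\<Theta>\<close>, and hence \<open>\<phi>\<close>, cannot be concentrated on a small part of \<open>G/K n\<close>.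

  Let \<open>H'\<close> be generated by these elements. Then \<open>H'\<close>-invariant sets have density bounded below, so
  \<open>H'\<close> has boundedly many orbits. If property \<open>(\<tau>)\<close> failed, there would be zero-mean functions on the
  orbits that are arbitrarily close to being invariant. Their positive or negative parts
  are somewhat concentrated, and products of such functions taken at successively deeper levels of
  the chain are almost independent, so they are almost invariant and arbitrarily concentrated.
\<close>

subsection \<open>Quadratic forms\<close>

text \<open>Tychonoff's theorem for functions on the whole type. It allows the unit sphere over a
  finite set to be treated inside the space of all functions, with values off the set pinned to
  0.\<close>

lemma compact_product_UNIV:
  fixes C :: "'x \<Rightarrow> real set"
  assumes "\<And>x. compact (C x)"
  shows "compact (PiE UNIV C)"
proof -
  have "compactin (product_topology (\<lambda>_. euclidean) UNIV) (PiE UNIV C)"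
    using assms by (simp add: compactin_PiE)
  then show ?thesis
    by (simp add: euclidean_product_topology)
qed

text \<open>Variational principle: on the unit sphere of zero-sum functions the form attains its
  maximum, and a maximiser is an eigenvector whose eigenvalue is the maximum. Symmetry together with
  constant row sums makes the matrix preserve the zero-sum space, so that no multiplier for the
  zero-sum constraint appears.\<close>

lemma zero_sum_quadratic_form_le:
  fixes a :: "'x \<Rightarrow> 'x \<Rightarrow> real" and \<theta> :: "'x \<Rightarrow> real"
  assumes fin: "finite X"
    and sym: "\<And>x y. x \<in> X \<Longrightarrow> y \<in> X \<Longrightarrow> a x y = a y x"
    and row: "\<And>x. x \<in> X \<Longrightarrow> (\<Sum>y\<in>X. a x y) = c"
    and eig: "\<And>\<mu> f. \<lbrakk>\<exists>x\<in>X. f x \<noteq> 0; (\<Sum>x\<in>X. f x) = 0; \<forall>x\<in>X. (\<Sum>y\<in>X. a x y * f y) = \<mu> * f x\<rbrakk> \<Longrightarrow> \<mu> \<le> r"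
    and zs: "(\<Sum>x\<in>X. \<theta> x) = 0"
  shows "(\<Sum>x\<in>X. \<Sum>y\<in>X. a x y * \<theta> y * \<theta> x) \<le> r * (\<Sum>x\<in>X. (\<theta> x)\<^sup>2)"
proof (cases "\<forall>x\<in>X. \<theta> x = 0")
  case True
  then show ?thesis by simp
next
  case False
  define q where "q f = (\<Sum>x\<in>X. \<Sum>y\<in>X. a x y * f y * f x)" for f :: "'x \<Rightarrow> real"
  \<comment> \<open>The unit sphere of zero-sum functions on \<open>X\<close>, extended by 0. The
    box exhibits it as a closed part of a compact product.\<close>
  define V where "V = PiE UNIV (\<lambda>x. if x \<in> X then {-1..1} else {0::real})
      \<inter> {f. (\<Sum>x\<in>X. f x) = 0} \<inter> {f. (\<Sum>x\<in>X. (f x)\<^sup>2) = 1}"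
  define nrm where "nrm f = (\<lambda>x. if x \<in> X then f x / sqrt (\<Sum>x\<in>X. (f x)\<^sup>2) else 0)" for f :: "'x \<Rightarrow> real"
  have pos: "(\<Sum>x\<in>X. (f x)\<^sup>2) > 0" if "\<exists>x\<in>X. f x \<noteq> 0" for f :: "'x \<Rightarrow> real"
    using that fin by (meson sum_pos2 zero_le_power2 zero_less_power2)
  have nV: "nrm f \<in> V" if "\<exists>x\<in>X. f x \<noteq> 0" "(\<Sum>x\<in>X. f x) = 0" for f
  proof -
    let ?s = "\<Sum>x\<in>X. (f x)\<^sup>2"
    have s: "?s > 0" using pos that by blast
    have "\<bar>f x\<bar> \<le> sqrt ?s" if "x \<in> X" for x
      using fin that by (intro real_le_rsqrt) (simp add: member_le_sum[of x X "\<lambda>x. (f x)\<^sup>2"])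
    then have "nrm f x \<in> {-1..1}" if "x \<in> X" for x
      using s that unfolding nrm_def by (fastforce simp: field_simps abs_le_iff)
    moreover have "(\<Sum>x\<in>X. nrm f x) = (\<Sum>x\<in>X. f x) / sqrt ?s"
      by (simp add: nrm_def sum_divide_distrib)
    moreover have "(\<Sum>x\<in>X. (nrm f x)\<^sup>2) = ?s / ?s"
    proof -
      have "(\<Sum>x\<in>X. (nrm f x)\<^sup>2) = (\<Sum>x\<in>X. (f x)\<^sup>2 / ?s)"
        using s by (intro sum.cong refl) (simp add: nrm_def power_divide)
      then show ?thesis by (simp only: sum_divide_distrib)
    qed
    ultimately show ?thesis
      using s that by (auto simp: V_def nrm_def)
  qed
  have qn: "q (nrm f) * (\<Sum>x\<in>X. (f x)\<^sup>2) = q f" if "\<exists>x\<in>X. f x \<noteq> 0" for f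
  proof -
    let ?s = "\<Sum>x\<in>X. (f x)\<^sup>2"
    have s: "?s > 0" using pos that by blast
    then have ss: "sqrt ?s * sqrt ?s = ?s" by simp
    have "q (nrm f) = (\<Sum>x\<in>X. \<Sum>y\<in>X. a x y * f y * f x / ?s)"
      unfolding q_def nrm_def using ss by (intro sum.cong refl) (auto simp: field_simps)
    also have "\<dots> = q f / ?s" by (simp add: q_def sum_divide_distrib)
    finally show ?thesis using s by simp
  qed
  have "compact V"
    unfolding V_def
    by (intro compact_Int_closed compact_product_UNIV closed_Collect_eq continuous_intros
        continuous_on_product_coordinates) auto
  moreover have "V \<noteq> {}" using nV[of \<theta>] False zs by blast
  moreover have "continuous_on V q"
    unfolding q_def
    by (intro continuous_intros continuous_on_subset[OF continuous_on_product_coordinates]) auto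
  ultimately obtain f0 where f0: "f0 \<in> V" "\<And>f. f \<in> V \<Longrightarrow> q f \<le> q f0"
    using continuous_attains_sup[of V q] by blast
  define \<mu> where "\<mu> = q f0"
  have f0z: "(\<Sum>x\<in>X. f0 x) = 0" and f0n: "(\<Sum>x\<in>X. (f0 x)\<^sup>2) = 1"
    using f0(1) by (auto simp: V_def)
  have max: "q f \<le> \<mu> * (\<Sum>x\<in>X. (f x)\<^sup>2)" if "(\<Sum>x\<in>X. f x) = 0" for f
  proof (cases "\<exists>x\<in>X. f x \<noteq> 0")
    case True
    then have "q (nrm f) \<le> \<mu>" using f0(2) nV that \<mu>_def by blast
    then have "q (nrm f) * (\<Sum>x\<in>X. (f x)\<^sup>2) \<le> \<mu> * (\<Sum>x\<in>X. (f x)\<^sup>2)"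
      using pos[OF True] by (intro mult_right_mono) auto
    then show ?thesis using qn[OF True] by simp
  next
    case False
    then show ?thesis by (simp add: q_def)
  qed
  \<comment> \<open>The defect of \<open>f0\<close> in the eigenvector equation. It has zero sum, so
    \<open>f0 + t * g\<close> is an admissible competitor for every \<open>t\<close>.\<close>
  define g where "g = (\<lambda>x. (\<Sum>y\<in>X. a x y * f0 y) - \<mu> * f0 x)"
  have "(\<Sum>x\<in>X. \<Sum>y\<in>X. a x y * f0 y) = (\<Sum>y\<in>X. \<Sum>x\<in>X. a y x * f0 y)"
    by (subst sum.swap) (intro sum.cong refl, simp add: sym)
  also have "\<dots> = (\<Sum>y\<in>X. c * f0 y)"
    by (intro sum.cong refl) (simp add: row flip: sum_distrib_right)
  also have "\<dots> = 0" using f0z by (simp flip: sum_distrib_left)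
  finally have gz: "(\<Sum>x\<in>X. g x) = 0"
    by (simp add: g_def sum_subtractf f0z flip: sum_distrib_left)
  define D where "D = (\<Sum>x\<in>X. g x * g x)"
  define E where "E = q g - \<mu> * (\<Sum>x\<in>X. (g x)\<^sup>2)"
  \<comment> \<open>Expanding the form at \<open>f0 + t * g\<close>, the first-order term is
    \<open>2 * t * D\<close> with \<open>D\<close> the squared norm of \<open>g\<close>. Maximality
    for small positive \<open>t\<close> therefore forces \<open>D = 0\<close>.\<close>
  have var: "2 * t * D + t\<^sup>2 * E \<le> 0" for t
  proof -
    have "(\<Sum>x\<in>X. f0 x + t * g x) = 0"
      by (simp add: sum.distrib f0z gz flip: sum_distrib_left)
    then have le: "q (\<lambda>x. f0 x + t * g x) \<le> \<mu> * (\<Sum>x\<in>X. (f0 x + t * g x)\<^sup>2)"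
      by (rule max)
    define P where "P = (\<Sum>x\<in>X. \<Sum>y\<in>X. a x y * f0 y * g x)"
    define R where "R = (\<Sum>x\<in>X. f0 x * g x)"
    have swap: "(\<Sum>x\<in>X. \<Sum>y\<in>X. a x y * g y * f0 x) = P"
      unfolding P_def by (subst sum.swap) (intro sum.cong refl, simp add: sym)
    have "q (\<lambda>x. f0 x + t * g x) = q f0 + t * P
        + t * (\<Sum>x\<in>X. \<Sum>y\<in>X. a x y * g y * f0 x) + t\<^sup>2 * q g"
      unfolding q_def P_def
      by (simp add: algebra_simps sum.distrib sum_distrib_left power2_eq_square)
    then have 1: "q (\<lambda>x. f0 x + t * g x) = \<mu> + 2 * t * P + t\<^sup>2 * q g"
      unfolding swap by (simp add: \<mu>_def)
    have 2: "(\<Sum>x\<in>X. (f0 x + t * g x)\<^sup>2) = 1 + 2 * t * R + t\<^sup>2 * (\<Sum>x\<in>X. (g x)\<^sup>2)"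
      using f0n by (simp add: R_def power2_sum power_mult_distrib sum.distrib sum_distrib_left algebra_simps)
    have 3: "D = P - \<mu> * R"
      unfolding D_def P_def R_def
      by (subst (1) g_def) (simp add: algebra_simps sum_subtractf sum_distrib_left)
    show ?thesis
      using le unfolding 1 2 3 E_def by (simp add: algebra_simps)
  qed
  have "D = 0"
  proof (rule ccontr)
    assume "D \<noteq> 0"
    moreover have "D \<ge> 0" unfolding D_def by (intro sum_nonneg) auto
    ultimately have D: "D > 0" by simp
    \<comment> \<open>Chosen so that \<open>t * \<bar>E\<bar> < D\<close>: the linear term then
      dominates the quadratic one.\<close>
    define t where "t = D / (1 + \<bar>E\<bar>)"
    have t: "t > 0" using D by (simp add: t_def add_pos_nonneg)
    have "t * \<bar>E\<bar> < D"
      using D by (simp add: t_def field_simps add_pos_nonneg)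
    then have "t * (2 * D + t * E) > 0"
      using t D mult_left_mono[OF abs_ge_minus_self[of E], of t] by (intro mult_pos_pos) auto
    with var[of t] show False by (simp add: power2_eq_square algebra_simps)
  qed
  then have "\<forall>x\<in>X. g x = 0"
    using fin by (simp add: D_def sum_nonneg_eq_0_iff)
  then have "\<forall>x\<in>X. (\<Sum>y\<in>X. a x y * f0 y) = \<mu> * f0 x" by (simp add: g_def)
  moreover have "\<exists>x\<in>X. f0 x \<noteq> 0" using f0n by (metis (mono_tags, lifting) sum.neutral zero_neq_one zero_power2)
  ultimately have "\<mu> \<le> r" using eig f0z by blast
  then show ?thesis
    using max[OF zs] mult_right_mono[of \<mu> r "\<Sum>x\<in>X. (\<theta> x)\<^sup>2"]
    by (simp add: q_def sum_nonneg)
qed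

section \<open>Quadratic forms of square-summable functions and their finite truncation\<close>

lemma summable_on_mult_of_squares:
  fixes f g :: "'x \<Rightarrow> real"
  assumes "(\<lambda>x. (f x)\<^sup>2) summable_on R" "(\<lambda>x. (g x)\<^sup>2) summable_on R"
  shows "(\<lambda>x. f x * g x) summable_on R"
proof -
  have "(\<lambda>x. norm (f x * g x)) summable_on R"
  proof (rule summable_on_comparison_test[OF summable_on_add[OF assms]])
    show "norm (f x * g x) \<le> (f x)\<^sup>2 + (g x)\<^sup>2" for x
    proof -
      have "2 * \<bar>f x\<bar> * \<bar>g x\<bar> \<le> (f x)\<^sup>2 + (g x)\<^sup>2"
        using sum_squares_bound[of "\<bar>f x\<bar>" "\<bar>g x\<bar>"] by simp
      moreover have "0 \<le> \<bar>f x\<bar> * \<bar>g x\<bar>" by simp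
      ultimately show ?thesis unfolding real_norm_def abs_mult by linarith
    qed
  qed auto
  then show ?thesis by (rule abs_summable_summable)
qed

lemma summable_on_translate_mult:
  fixes f :: "'x \<Rightarrow> real"
  assumes "(\<lambda>x. (f x)\<^sup>2) summable_on R" "bij_betw h R R"
  shows "(\<lambda>x. f (h x) * f x) summable_on R"
  using assms summable_on_reindex_bij_betw[OF assms(2), of "\<lambda>x. (f x)\<^sup>2"]
  by (intro summable_on_mult_of_squares) simp_all

lemma infsum_finite_sum:
  fixes f :: "'s \<Rightarrow> 'x \<Rightarrow> real"
  assumes "finite S" "\<And>s. s \<in> S \<Longrightarrow> f s summable_on R"
  shows "(\<Sum>\<^sub>\<infinity>x\<in>R. \<Sum>s\<in>S. f s x) = (\<Sum>s\<in>S. \<Sum>\<^sub>\<infinity>x\<in>R. f s x)"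
proof -
  have "((\<lambda>x. \<Sum>s\<in>S. f s x) has_sum (\<Sum>s\<in>S. \<Sum>\<^sub>\<infinity>x\<in>R. f s x)) R"
    using assms by (induction S rule: finite_induct) (auto intro!: has_sum_add has_sum_infsum)
  then show ?thesis by (rule infsumI)
qed

text \<open>Both sides are limits along the finite subsets of \<open>R\<close>, so a strict
  inequality already holds at some finite stage. Truncating \<open>f\<close> to \<open>F\<close>
  loses the terms whose translate leaves \<open>F\<close>, which is harmless in the limit.\<close>

lemma finite_truncation_quadratic_form:
  fixes f :: "'x \<Rightarrow> real" and \<sigma> :: "'s \<Rightarrow> 'x \<Rightarrow> 'x"
  assumes sq: "(\<lambda>x. (f x)\<^sup>2) summable_on R"
    and bij: "\<And>s. s \<in> S \<Longrightarrow> bij_betw (\<sigma> s) R R"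
    and gt: "(\<Sum>s\<in>S. \<Sum>\<^sub>\<infinity>x\<in>R. f (\<sigma> s x) * f x) > c * (\<Sum>\<^sub>\<infinity>x\<in>R. (f x)\<^sup>2)"
  obtains F where "finite F" "F \<subseteq> R"
    "(\<Sum>s\<in>S. \<Sum>x\<in>{x\<in>F. \<sigma> s x \<in> F}. f (\<sigma> s x) * f x) > c * (\<Sum>x\<in>F. (f x)\<^sup>2)"
proof -
  let ?A = "finite_subsets_at_top R"
  have lim: "((\<lambda>F. \<Sum>x\<in>{x\<in>F. \<sigma> s x \<in> F}. f (\<sigma> s x) * f x) \<longlongrightarrow> (\<Sum>\<^sub>\<infinity>x\<in>R. f (\<sigma> s x) * f x)) ?A"
    if s: "s \<in> S" for s
  proof -
    have b: "bij_betw (\<sigma> s) R R" using bij s .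
    have "(\<lambda>x. f (\<sigma> s x) * f x) summable_on R"
      using summable_on_translate_mult[OF sq b] .
    then have "((\<lambda>F. \<Sum>x\<in>F. f (\<sigma> s x) * f x) \<longlongrightarrow> (\<Sum>\<^sub>\<infinity>x\<in>R. f (\<sigma> s x) * f x)) ?A"
      by (rule infsum_tendsto)
    \<comment> \<open>A finite \<open>Y\<close> lies in the truncated index set as soon as
      \<open>F\<close> contains both \<open>Y\<close> and its image under
      \<open>\<sigma> s\<close>.\<close>
    moreover have "filterlim (\<lambda>F. {x\<in>F. \<sigma> s x \<in> F}) ?A ?A"
      unfolding filterlim_iff eventually_finite_subsets_at_top
    proof (intro allI impI, elim exE conjE)
      fix P Y assume Y: "finite Y" "Y \<subseteq> R" and P: "\<forall>Z. finite Z \<and> Y \<subseteq> Z \<and> Z \<subseteq> R \<longrightarrow> P Z"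
      have img: "\<sigma> s ` Y \<subseteq> R" using b Y by (auto simp: bij_betw_def)
      show "\<exists>W. finite W \<and> W \<subseteq> R \<and> (\<forall>Z. finite Z \<and> W \<subseteq> Z \<and> Z \<subseteq> R \<longrightarrow> P {x\<in>Z. \<sigma> s x \<in> Z})"
      proof (intro exI[of _ "Y \<union> \<sigma> s ` Y"] conjI allI impI)
        show "finite (Y \<union> \<sigma> s ` Y)" "Y \<union> \<sigma> s ` Y \<subseteq> R"
          using Y img by auto
        show "P {x\<in>Z. \<sigma> s x \<in> Z}" if "finite Z \<and> Y \<union> \<sigma> s ` Y \<subseteq> Z \<and> Z \<subseteq> R" for Z
          using that by (intro P[rule_format]) auto
      qed
    qed
    ultimately show ?thesis by (rule filterlim_compose)
  qed
  have "((\<lambda>F. (\<Sum>s\<in>S. \<Sum>x\<in>{x\<in>F. \<sigma> s x \<in> F}. f (\<sigma> s x) * f x) - c * (\<Sum>x\<in>F. (f x)\<^sup>2))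
      \<longlongrightarrow> (\<Sum>s\<in>S. \<Sum>\<^sub>\<infinity>x\<in>R. f (\<sigma> s x) * f x) - c * (\<Sum>\<^sub>\<infinity>x\<in>R. (f x)\<^sup>2)) ?A"
    by (intro tendsto_intros lim infsum_tendsto sq)
  then have "\<forall>\<^sub>F F in ?A. (\<Sum>s\<in>S. \<Sum>x\<in>{x\<in>F. \<sigma> s x \<in> F}. f (\<sigma> s x) * f x) - c * (\<Sum>x\<in>F. (f x)\<^sup>2) > 0"
    by (rule order_tendstoD(1)) (use gt in simp)
  moreover have "\<forall>\<^sub>F F in ?A. finite F \<and> F \<subseteq> R"
    by (rule eventually_finite_subsets_at_top_weakI) auto
  ultimately have "\<forall>\<^sub>F F in ?A. finite F \<and> F \<subseteq> R \<and>
      (\<Sum>s\<in>S. \<Sum>x\<in>{x\<in>F. \<sigma> s x \<in> F}. f (\<sigma> s x) * f x) > c * (\<Sum>x\<in>F. (f x)\<^sup>2)"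
    by eventually_elim auto
  then obtain F where "finite F \<and> F \<subseteq> R \<and>
      (\<Sum>s\<in>S. \<Sum>x\<in>{x\<in>F. \<sigma> s x \<in> F}. f (\<sigma> s x) * f x) > c * (\<Sum>x\<in>F. (f x)\<^sup>2)"
    using eventually_happens'[OF finite_subsets_at_top_neq_bot] by blast
  then show ?thesis using that by blast
qed

subsection \<open>Averages over coset spaces\<close>

text \<open>Normalised by the size of the set, so that pulling a function back to a deeper level of
  a chain leaves its average unchanged (\<open>avg_proj\<close>).\<close>

definition avg :: "'x set \<Rightarrow> ('x \<Rightarrow> real) \<Rightarrow> real" where
  "avg A f = (\<Sum>x\<in>A. f x) / real (card A)"

lemma avg_cong: "(\<And>x. x \<in> A \<Longrightarrow> f x = g x) \<Longrightarrow> avg A f = avg A g"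
  by (simp add: avg_def)

lemma avg_add: "avg A (\<lambda>x. f x + g x) = avg A f + avg A g"
  by (simp add: avg_def sum.distrib add_divide_distrib)

lemma avg_diff: "avg A (\<lambda>x. f x - g x) = avg A f - avg A g"
  by (simp add: avg_def sum_subtractf diff_divide_distrib)

lemma avg_cmult: "avg A (\<lambda>x. c * f x) = c * avg A f"
  by (simp add: avg_def flip: sum_distrib_left)

lemma avg_sum: "avg A (\<lambda>x. \<Sum>i\<in>I. f i x) = (\<Sum>i\<in>I. avg A (f i))"
  by (simp add: avg_def sum.swap[of _ I] flip: sum_divide_distrib)

lemma avg_mono: "(\<And>x. x \<in> A \<Longrightarrow> f x \<le> g x) \<Longrightarrow> avg A f \<le> avg A g"
  by (simp add: avg_def divide_right_mono sum_mono)

lemma avg_nonneg: "(\<And>x. x \<in> A \<Longrightarrow> 0 \<le> f x) \<Longrightarrow> 0 \<le> avg A f"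
  by (simp add: avg_def sum_nonneg)

lemma avg_const: "finite A \<Longrightarrow> A \<noteq> {} \<Longrightarrow> avg A (\<lambda>_. c) = c"
  by (simp add: avg_def)

lemma avg_reindex: "bij_betw h A A \<Longrightarrow> avg A (\<lambda>x. f (h x)) = avg A f"
  by (simp add: avg_def sum.reindex_bij_betw)

lemma avg_abs: "\<bar>avg A f\<bar> \<le> avg A (\<lambda>x. \<bar>f x\<bar>)"
  by (simp add: avg_def divide_right_mono)

lemma avg_Cauchy_Schwarz: "(avg A (\<lambda>x. f x * g x))\<^sup>2 \<le> avg A (\<lambda>x. (f x)\<^sup>2) * avg A (\<lambda>x. (g x)\<^sup>2)"
  unfolding avg_def power_divide times_divide_times_eq power2_eq_square[of "real (card A)"]
  by (intro divide_right_mono Cauchy_Schwarz_ineq_sum) simp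

lemma avg_square_le:
  assumes "finite A"
  shows "(avg A f)\<^sup>2 \<le> avg A (\<lambda>x. (f x)\<^sup>2)"
proof (cases "A = {}")
  case False
  then show ?thesis
    using avg_Cauchy_Schwarz[of A f "\<lambda>_. 1"] assms by (simp add: avg_const)
qed (simp add: avg_def)

text \<open>The positive and negative parts have the same mean and disjoint supports, so one of them
  must have a mean square exceeding the square of its mean by a definite factor.\<close>

lemma zero_mean_half_concentrated:
  fixes f :: "'x \<Rightarrow> real"
  assumes fin: "finite A" and z: "avg A f = 0" and one: "avg A (\<lambda>x. (f x)\<^sup>2) = 1"
  shows "\<exists>\<sigma>\<in>{1,-1}. avg A (\<lambda>x. (max 0 (\<sigma> * f x))\<^sup>2) \<ge> 1/3 \<and>
    (avg A (\<lambda>x. max 0 (\<sigma> * f x)))\<^sup>2 \<le> 1/2 * avg A (\<lambda>x. (max 0 (\<sigma> * f x))\<^sup>2)"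
proof -
  have ne: "A \<noteq> {}" using one by (auto simp: avg_def)
  define P where "P \<sigma> = avg A (\<lambda>x. (max 0 (\<sigma> * f x))\<^sup>2)" for \<sigma>
  define a where "a \<sigma> = avg A (\<lambda>x. max 0 (\<sigma> * f x))" for \<sigma>
  \<comment> \<open>The densities of the sets where \<open>f\<close> is positive and where it is
    negative; being disjoint, one of them is at most 1/2.\<close>
  define w where "w \<sigma> = avg A (\<lambda>x. if \<sigma> * f x > 0 then 1 else 0)" for \<sigma>
  have "a 1 - a (-1) = avg A f"
    unfolding a_def avg_diff[symmetric] by (intro avg_cong) (auto simp: max_def)
  then have a: "a (-1) = a 1" using z by simp
  have "P 1 + P (-1) = avg A (\<lambda>x. (f x)\<^sup>2)"
    unfolding P_def avg_add[symmetric] by (intro avg_cong) (auto simp: max_def)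
  then have P: "P 1 + P (-1) = 1" using one by simp
  have "w 1 + w (-1) \<le> avg A (\<lambda>_. 1)"
    unfolding w_def avg_add[symmetric] by (intro avg_mono) auto
  then have w: "w 1 + w (-1) \<le> 1" using fin ne by (simp add: avg_const)
  have P0: "P \<sigma> \<ge> 0" for \<sigma> unfolding P_def by (intro avg_nonneg) auto
  have w0: "w \<sigma> \<ge> 0" for \<sigma> unfolding w_def by (intro avg_nonneg) auto
  \<comment> \<open>Cauchy-Schwarz against the indicator of the support.\<close>
  have cs: "(a \<sigma>)\<^sup>2 \<le> w \<sigma> * P \<sigma>" for \<sigma>
  proof -
    have "a \<sigma> = avg A (\<lambda>x. (if \<sigma> * f x > 0 then 1 else 0) * max 0 (\<sigma> * f x))"
      unfolding a_def by (intro avg_cong) auto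
    moreover have "w \<sigma> = avg A (\<lambda>x. (if \<sigma> * f x > 0 then 1 else 0)\<^sup>2)"
      unfolding w_def by (intro avg_cong) auto
    ultimately show ?thesis
      unfolding P_def using avg_Cauchy_Schwarz by metis
  qed
  have cs1: "(a 1)\<^sup>2 \<le> w 1 * P 1" and cs2: "(a 1)\<^sup>2 \<le> w (-1) * P (-1)"
    using cs[of 1] cs[of "-1"] a by simp_all
  have le: "(a 1)\<^sup>2 \<le> P 1" "(a 1)\<^sup>2 \<le> P (-1)"
    using cs1 cs2 w w0[of 1] w0[of "-1"] P0[of 1] P0[of "-1"]
      mult_right_mono[of "w 1" 1 "P 1"] mult_right_mono[of "w (-1)" 1 "P (-1)"] by linarith+
  have half: "(a 1)\<^sup>2 \<le> 1/2 * P 1 \<or> (a 1)\<^sup>2 \<le> 1/2 * P (-1)"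
  proof (cases "w 1 \<le> 1/2")
    case True
    then show ?thesis using cs1 mult_right_mono[OF True P0[of 1]] by linarith
  next
    case False
    then have "w (-1) \<le> 1/2" using w by simp
    then show ?thesis using cs2 mult_right_mono[OF _ P0[of "-1"], of "w (-1)" "1/2"] by linarith
  qed
  \<comment> \<open>If one part has mean square below 1/3, the other has more than 2/3, and the
    common squared mean, bounded by the smaller mean square, is less than half of the larger.
    Otherwise both exceed the threshold and the part of density at most 1/2 works.\<close>
  have "(P 1 \<ge> 1/3 \<and> (a 1)\<^sup>2 \<le> 1/2 * P 1) \<or> (P (-1) \<ge> 1/3 \<and> (a 1)\<^sup>2 \<le> 1/2 * P (-1))"
  proof (cases "P 1 < 1/3 \<or> P (-1) < 1/3")
    case True
    then show ?thesis using le P by auto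
  next
    case False
    then show ?thesis using half by auto
  qed
  then show ?thesis unfolding P_def[symmetric] a_def[symmetric] using a by auto
qed

section \<open>The translation action on left cosets and the projections between coset
  spaces\<close>

context group begin

lemma lcoset_in_lcosets: "a \<in> carrier G \<Longrightarrow> a <# L \<in> lcosets L"
  by (auto simp: LCOSETS_def)

lemma lcosetsE:
  assumes "Y \<in> lcosets L"
  obtains a where "a \<in> carrier G" "Y = a <# L"
  using assms by (auto simp: LCOSETS_def)

lemma lcosets_subset:
  assumes "subgroup L G" "Y \<in> lcosets L"
  shows "Y \<subseteq> carrier G"
  using assms subgroup.lcosets_carrier is_group by blast

lemma lcosets_act_mult:
  assumes "subgroup L G" "Y \<in> lcosets L" "g \<in> carrier G" "h \<in> carrier G"
  shows "(g \<otimes> h) <# Y = g <# (h <# Y)"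
  using lcos_m_assoc[OF lcosets_subset[OF assms(1,2)] assms(3,4)] by simp

lemma lcosets_act_closed:
  assumes "subgroup L G" "Y \<in> lcosets L" "g \<in> carrier G"
  shows "g <# Y \<in> lcosets L"
  using assms by (elim lcosetsE) (simp add: lcos_m_assoc subgroup.subset lcoset_in_lcosets)

lemma lcosets_act_one:
  assumes "subgroup L G" "Y \<in> lcosets L"
  shows "\<one> <# Y = Y"
  using lcos_mult_one[OF lcosets_subset[OF assms]] .

lemma lcosets_act_inv:
  assumes "subgroup L G" "Y \<in> lcosets L" "g \<in> carrier G"
  shows "inv g <# (g <# Y) = Y" "g <# (inv g <# Y) = Y"
  using assms by (simp_all add: lcosets_act_one flip: lcosets_act_mult)

lemma lcosets_act_bij:
  assumes "subgroup L G" "g \<in> carrier G"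
  shows "bij_betw (\<lambda>Y. g <# Y) (lcosets L) (lcosets L)"
  using assms
  by (intro bij_betwI[of _ _ _ "\<lambda>Y. inv g <# Y"]) (auto simp: lcosets_act_closed lcosets_act_inv)

lemma lcosets_act_transitive:
  assumes "subgroup L G" "Y \<in> lcosets L" "Y' \<in> lcosets L"
  shows "\<exists>h\<in>carrier G. h <# Y = Y'"
proof -
  obtain a b where ab: "a \<in> carrier G" "b \<in> carrier G" "Y = a <# L" "Y' = b <# L"
    using assms by (metis lcosetsE)
  then have "(b \<otimes> inv a) <# Y = Y'"
    using assms by (simp add: lcos_m_assoc subgroup.subset m_assoc)
  then show ?thesis using ab by blast
qed

text \<open>Shows that \<open>Y <#> L'\<close> is the natural projection from G/L to G/L', written
  without a choice of representatives. It rests on \<open>L <#> L' = L'\<close>.\<close>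

lemma lcoset_mult_supergroup:
  assumes "subgroup L G" "subgroup L' G" "L \<subseteq> L'" "a \<in> carrier G"
  shows "(a <# L) <#> L' = a <# L'"
proof -
  have "L <#> L' = L'"
  proof
    show "L <#> L' \<subseteq> L'"
      using assms subgroup.m_closed[OF assms(2)] by (auto simp: set_mult_def)
    show "L' \<subseteq> L <#> L'"
    proof
      fix x assume "x \<in> L'"
      then have "x = \<one> \<otimes> x" using subgroup.mem_carrier[OF assms(2)] by simp
      then show "x \<in> L <#> L'"
        using \<open>x \<in> L'\<close> subgroup.one_closed[OF assms(1)] unfolding set_mult_def by blast
    qed
  qed
  then show ?thesis
    using assms setmult_lcos_assoc[of L L' a] by (simp add: subgroup.subset)
qed

lemma lcosets_proj_closed:
  assumes "subgroup L G" "subgroup L' G" "L \<subseteq> L'" "Y \<in> lcosets L"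
  shows "Y <#> L' \<in> lcosets L'"
  using assms by (elim lcosetsE) (simp add: lcoset_mult_supergroup lcoset_in_lcosets)

lemma lcosets_proj_act:
  assumes "subgroup L G" "subgroup L' G" "L \<subseteq> L'" "Y \<in> lcosets L" "g \<in> carrier G"
  shows "(g <# Y) <#> L' = g <# (Y <#> L')"
  using assms by (elim lcosetsE) (simp add: lcoset_mult_supergroup lcos_m_assoc subgroup.subset)

end

subsection \<open>Chains without property \<open>(\<tau>)\<close>\<close>

text \<open>To be instantiated with the finitely generated subgroup in the role of \<open>G\<close>,
  the traces of the given chain on it as \<open>L\<close>, and its finite generating set as
  \<open>T\<close>.\<close>

locale subgroup_chain = group G for G (structure) +
  fixes L :: "nat \<Rightarrow> 'a set" and T :: "'a set"
  assumes sub: "subgroup (L n) G"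
    and fin: "finite (lcosets (L n))"
    and dec: "decseq L"
    and T_carrier: "T \<subseteq> carrier G"
    and T_fin: "finite T"
    and T_gen: "generate G T = carrier G"
begin

abbreviation X :: "nat \<Rightarrow> 'a set set" where "X n \<equiv> lcosets (L n)"

abbreviation proj :: "nat \<Rightarrow> 'a set \<Rightarrow> 'a set" where "proj n Y \<equiv> Y <#> L n"

lemma L_mono: "n \<le> m \<Longrightarrow> L m \<subseteq> L n"
  using dec by (simp add: decseq_def)

lemma T_closed: "t \<in> T \<Longrightarrow> t \<in> carrier G"
  using T_carrier by blast

lemma X_nonempty: "X n \<noteq> {}"
  using lcoset_in_lcosets[OF one_closed] by blast

lemma proj_closed: "n \<le> m \<Longrightarrow> z \<in> X m \<Longrightarrow> proj n z \<in> X n"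
  using lcosets_proj_closed[OF sub sub L_mono] .

lemma proj_act: "n \<le> m \<Longrightarrow> z \<in> X m \<Longrightarrow> g \<in> carrier G \<Longrightarrow> proj n (g <# z) = g <# proj n z"
  using lcosets_proj_act[OF sub sub L_mono] .

lemma act_closed: "z \<in> X m \<Longrightarrow> g \<in> carrier G \<Longrightarrow> g <# z \<in> X m"
  using lcosets_act_closed[OF sub] .

lemma avg_act: "g \<in> carrier G \<Longrightarrow> avg (X m) (\<lambda>z. v (g <# z)) = avg (X m) v"
  using avg_reindex[OF lcosets_act_bij[OF sub]] .

text \<open>Write \<open>h\<close> as a word in \<open>T\<close> and its inverses. Translations
  preserve averages, so the variation is subadditive along the word and inverting a letter does not
  change it; \<open>C\<close> is the length of the word. The point is that \<open>C\<close> depends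
  on neither the level \<open>m\<close> nor the function \<open>v\<close>.\<close>

lemma variation_word_bound:
  assumes "h \<in> carrier G"
  shows "\<exists>C\<ge>0. \<forall>m v \<eta>. (\<forall>t\<in>T. avg (X m) (\<lambda>z. \<bar>v (t <# z) - v z\<bar>) \<le> \<eta>) \<longrightarrow>
    avg (X m) (\<lambda>z. \<bar>v (h <# z) - v z\<bar>) \<le> C * \<eta>"
proof -
  have "h \<in> generate G T" using assms T_gen by simp
  then show ?thesis
  proof (induction rule: generate.induct)
    case one
    have "avg (X m) (\<lambda>z. \<bar>v (\<one> <# z) - v z\<bar>) = avg (X m) (\<lambda>_. 0)" for m and v :: "'a set \<Rightarrow> real"
      by (intro avg_cong) (simp add: lcosets_act_one[OF sub])
    then have "avg (X m) (\<lambda>z. \<bar>v (\<one> <# z) - v z\<bar>) = 0" for m and v :: "'a set \<Rightarrow> real"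
      by (simp add: avg_def)
    then show ?case by (intro exI[of _ 0]) simp
  next
    case (incl t)
    then show ?case by (intro exI[of _ 1]) simp
  next
    case (inv t)
    have "avg (X m) (\<lambda>z. \<bar>v (inv t <# z) - v z\<bar>) = avg (X m) (\<lambda>z. \<bar>v (t <# z) - v z\<bar>)"
      for m and v :: "'a set \<Rightarrow> real"
    proof -
      have "avg (X m) (\<lambda>z. \<bar>v (inv t <# z) - v z\<bar>) = avg (X m) (\<lambda>z. \<bar>v (inv t <# (t <# z)) - v (t <# z)\<bar>)"
        using avg_act[OF T_closed[OF inv], of m "\<lambda>z. \<bar>v (inv t <# z) - v z\<bar>"] by simp
      also have "\<dots> = avg (X m) (\<lambda>z. \<bar>v (t <# z) - v z\<bar>)"
        by (intro avg_cong) (simp add: lcosets_act_inv[OF sub] T_closed[OF inv] abs_minus_commute)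
      finally show ?thesis .
    qed
    then show ?case using inv by (intro exI[of _ 1]) simp
  next
    case (eng h1 h2)
    then have c: "h1 \<in> carrier G" "h2 \<in> carrier G" using T_gen by auto
    obtain C1 where C1: "C1 \<ge> 0" "\<And>m v \<eta>. (\<forall>t\<in>T. avg (X m) (\<lambda>z. \<bar>v (t <# z) - v z\<bar>) \<le> \<eta>) \<Longrightarrow>
        avg (X m) (\<lambda>z. \<bar>v (h1 <# z) - v z\<bar>) \<le> C1 * \<eta>" using eng.IH(1) by blast
    obtain C2 where C2: "C2 \<ge> 0" "\<And>m v \<eta>. (\<forall>t\<in>T. avg (X m) (\<lambda>z. \<bar>v (t <# z) - v z\<bar>) \<le> \<eta>) \<Longrightarrow>
        avg (X m) (\<lambda>z. \<bar>v (h2 <# z) - v z\<bar>) \<le> C2 * \<eta>" using eng.IH(2) by blast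
    have "avg (X m) (\<lambda>z. \<bar>v (h1 \<otimes> h2 <# z) - v z\<bar>) \<le> (C1 + C2) * \<eta>"
      if "\<forall>t\<in>T. avg (X m) (\<lambda>z. \<bar>v (t <# z) - v z\<bar>) \<le> \<eta>" for m v \<eta>
    proof -
      have "avg (X m) (\<lambda>z. \<bar>v (h1 \<otimes> h2 <# z) - v z\<bar>)
          \<le> avg (X m) (\<lambda>z. \<bar>v (h1 <# (h2 <# z)) - v (h2 <# z)\<bar> + \<bar>v (h2 <# z) - v z\<bar>)"
        by (intro avg_mono) (simp add: lcosets_act_mult[OF sub] c)
      also have "\<dots> = avg (X m) (\<lambda>z. \<bar>v (h1 <# z) - v z\<bar>) + avg (X m) (\<lambda>z. \<bar>v (h2 <# z) - v z\<bar>)"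
        using avg_act[OF c(2), of m "\<lambda>z. \<bar>v (h1 <# z) - v z\<bar>"] by (simp add: avg_add)
      also have "\<dots> \<le> C1 * \<eta> + C2 * \<eta>" using C1(2)[OF that] C2(2)[OF that] by simp
      finally show ?thesis by (simp add: algebra_simps)
    qed
    then show ?case using C1(1) C2(1) by (intro exI[of _ "C1 + C2"]) simp
  qed
qed

text \<open>An almost invariant function at a deep level is nearly equidistributed over the cosets of
  a fixed level, because these are permuted transitively by finitely many words in \<open>T\<close>.\<close>

lemma decorrelation:
  "\<exists>C\<ge>0. \<forall>m\<ge>n. \<forall>B v \<eta> b. 0 \<le> \<eta> \<longrightarrow> (\<forall>t\<in>T. avg (X m) (\<lambda>z. \<bar>v (t <# z) - v z\<bar>) \<le> \<eta>) \<longrightarrow>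
    (\<forall>y\<in>X n. \<bar>B y\<bar> \<le> b) \<longrightarrow>
    \<bar>avg (X m) (\<lambda>z. B (proj n z) * v z) - avg (X n) B * avg (X m) v\<bar> \<le> C * b * \<eta>"
proof -
  \<comment> \<open>A fixed element carrying \<open>y\<close> to \<open>y'\<close>. Only finitely
    many are involved at level \<open>n\<close>, so their word constants have the common bound
    \<open>C0\<close>.\<close>
  define h where "h y y' = (SOME h. h \<in> carrier G \<and> h <# y = y')" for y y'
  have h': "h y y' \<in> carrier G \<and> h y y' <# y = y'" if "y \<in> X n" "y' \<in> X n" for y y'
    unfolding h_def by (rule someI_ex) (use lcosets_act_transitive[OF sub that] in blast)
  then have h: "h y y' \<in> carrier G" "h y y' <# y = y'" if "y \<in> X n" "y' \<in> X n" for y y'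
    using that by blast+
  have "\<forall>p\<in>X n \<times> X n. \<exists>C. C \<ge> 0 \<and> (\<forall>m v \<eta>. (\<forall>t\<in>T. avg (X m) (\<lambda>z. \<bar>v (t <# z) - v z\<bar>) \<le> \<eta>) \<longrightarrow>
      avg (X m) (\<lambda>z. \<bar>v (h (fst p) (snd p) <# z) - v z\<bar>) \<le> C * \<eta>)"
  proof
    fix p assume "p \<in> X n \<times> X n"
    then have "h (fst p) (snd p) \<in> carrier G" by (intro h(1)) auto
    from variation_word_bound[OF this]
    show "\<exists>C. C \<ge> 0 \<and> (\<forall>m v \<eta>. (\<forall>t\<in>T. avg (X m) (\<lambda>z. \<bar>v (t <# z) - v z\<bar>) \<le> \<eta>) \<longrightarrow>
      avg (X m) (\<lambda>z. \<bar>v (h (fst p) (snd p) <# z) - v z\<bar>) \<le> C * \<eta>)" .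
  qed
  from bchoice[OF this] obtain C where C': "\<forall>p\<in>X n \<times> X n. C p \<ge> 0 \<and>
      (\<forall>m v \<eta>. (\<forall>t\<in>T. avg (X m) (\<lambda>z. \<bar>v (t <# z) - v z\<bar>) \<le> \<eta>) \<longrightarrow>
      avg (X m) (\<lambda>z. \<bar>v (h (fst p) (snd p) <# z) - v z\<bar>) \<le> C p * \<eta>)" ..
  have C: "C p \<ge> 0"
    "\<forall>t\<in>T. avg (X m) (\<lambda>z. \<bar>v (t <# z) - v z\<bar>) \<le> \<eta> \<Longrightarrow>
      avg (X m) (\<lambda>z. \<bar>v (h (fst p) (snd p) <# z) - v z\<bar>) \<le> C p * \<eta>"
    if "p \<in> X n \<times> X n" for p m v \<eta>
    using C'[rule_format, OF that] by simp_all
  define C0 where "C0 = (\<Sum>p\<in>X n \<times> X n. C p)"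
  have C0: "C p \<le> C0" if "p \<in> X n \<times> X n" for p
    unfolding C0_def using that fin C(1) by (intro member_le_sum) auto
  have C00: "C0 \<ge> 0" unfolding C0_def using C(1) by (intro sum_nonneg) blast
  define N where "N = real (card (X n))"
  have N: "N > 0" using fin X_nonempty by (simp add: N_def card_gt_0_iff)
  have "\<bar>avg (X m) (\<lambda>z. B (proj n z) * v z) - avg (X n) B * avg (X m) v\<bar> \<le> (N * C0) * b * \<eta>"
    if m: "n \<le> m" and \<eta>: "0 \<le> \<eta>" and inv: "\<forall>t\<in>T. avg (X m) (\<lambda>z. \<bar>v (t <# z) - v z\<bar>) \<le> \<eta>"
      and b: "\<forall>y\<in>X n. \<bar>B y\<bar> \<le> b" for m B v \<eta> b
  proof -
    \<comment> \<open>The share of the average of \<open>v\<close> contributed by the fibre over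
      \<open>y\<close>.\<close>
    define s where "s y = avg (X m) (\<lambda>z. if proj n z = y then v z else 0)" for y
    \<comment> \<open>Translation by \<open>h y y'\<close> carries the fibre over \<open>y\<close>
      onto the fibre over \<open>y'\<close>, so the two shares differ by at most the variation of
      \<open>v\<close> under this word.\<close>
    have s: "\<bar>s y - s y'\<bar> \<le> C0 * \<eta>" if y: "y \<in> X n" "y' \<in> X n" for y y'
    proof -
      have p: "(y, y') \<in> X n \<times> X n" using y by simp
      let ?h = "h y y'"
      have "s y' = avg (X m) (\<lambda>z. if proj n (?h <# z) = y' then v (?h <# z) else 0)"
        unfolding s_def
        using avg_act[OF h(1)[OF y], of m "\<lambda>z. if proj n z = y' then v z else 0"] by simp
      also have "\<dots> = avg (X m) (\<lambda>z. if proj n z = y then v (?h <# z) else 0)"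
      proof (intro avg_cong)
        fix z assume z: "z \<in> X m"
        have "proj n (?h <# z) = y' \<longleftrightarrow> ?h <# proj n z = ?h <# y"
          using proj_act[OF m z h(1)[OF y]] h(2)[OF y] by simp
        also have "\<dots> \<longleftrightarrow> proj n z = y"
          using lcosets_act_inv(1)[OF sub proj_closed[OF m z] h(1)[OF y]]
            lcosets_act_inv(1)[OF sub y(1) h(1)[OF y]] by metis
        finally show "(if proj n (?h <# z) = y' then v (?h <# z) else 0) =
            (if proj n z = y then v (?h <# z) else 0)" by simp
      qed
      finally have "s y - s y' = avg (X m) (\<lambda>z. if proj n z = y then v z - v (?h <# z) else 0)"
        unfolding s_def by (simp add: avg_diff[symmetric]) (intro avg_cong, simp)
      also have "\<bar>\<dots>\<bar> \<le> avg (X m) (\<lambda>z. \<bar>v (?h <# z) - v z\<bar>)"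
        by (rule order_trans[OF avg_abs], rule avg_mono) auto
      also have "\<dots> \<le> C (y, y') * \<eta>" using C(2)[OF p inv] by simp
      also have "\<dots> \<le> C0 * \<eta>" using C0[OF p] \<eta> by (rule mult_right_mono)
      finally show ?thesis .
    qed
    have split: "avg (X m) (\<lambda>z. F (proj n z) * v z) = (\<Sum>y\<in>X n. F y * s y)" for F
    proof -
      have "avg (X m) (\<lambda>z. F (proj n z) * v z)
          = avg (X m) (\<lambda>z. \<Sum>y\<in>X n. F y * (if proj n z = y then v z else 0))"
        using proj_closed[OF m] fin
        by (intro avg_cong) (simp add: if_distrib sum.delta cong: if_cong)
      then show ?thesis by (simp add: avg_sum avg_cmult s_def)
    qed
    have sv: "avg (X m) v = (\<Sum>y\<in>X n. s y)"
      using split[of "\<lambda>_. 1"] by simp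
    \<comment> \<open>The correlation defect is \<open>B\<close> summed against the deviations of
      the fibre shares from their common mean, each of which is an average of differences bounded by
      \<open>s\<close>.\<close>
    have "avg (X m) (\<lambda>z. B (proj n z) * v z) - avg (X n) B * avg (X m) v
        = (\<Sum>y\<in>X n. B y * ((\<Sum>y'\<in>X n. s y - s y') / N))"
    proof -
      have "B y * ((\<Sum>y'\<in>X n. s y - s y') / N) = B y * s y - B y * ((\<Sum>y'\<in>X n. s y') / N)" for y
        using N by (simp add: sum_subtractf N_def[symmetric] field_simps)
      moreover have "avg (X n) B * c = (\<Sum>y\<in>X n. B y * (c / N))" for c
        by (simp add: avg_def N_def sum_distrib_right sum_divide_distrib)
      ultimately show ?thesis
        unfolding split sv by (simp only: sum_subtractf)
    qed
    also have "\<bar>\<dots>\<bar> \<le> (\<Sum>y\<in>X n. b * (C0 * \<eta>))"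
    proof (rule order_trans[OF sum_abs], rule sum_mono)
      fix y assume y: "y \<in> X n"
      have "\<bar>\<Sum>y'\<in>X n. s y - s y'\<bar> \<le> (\<Sum>y'\<in>X n. C0 * \<eta>)"
        by (rule order_trans[OF sum_abs], rule sum_mono) (use s y in blast)
      then have "\<bar>(\<Sum>y'\<in>X n. s y - s y') / N\<bar> \<le> C0 * \<eta>"
        using N by (simp add: N_def field_simps)
      moreover have "\<bar>B y\<bar> \<le> b" using b y by blast
      ultimately show "\<bar>B y * ((\<Sum>y'\<in>X n. s y - s y') / N)\<bar> \<le> b * (C0 * \<eta>)"
        unfolding abs_mult by (intro mult_mono) auto
    qed
    also have "\<dots> = (N * C0) * b * \<eta>" by (simp add: N_def)
    finally show ?thesis .
  qed
  moreover have "N * C0 \<ge> 0" using N C00 by simp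
  ultimately show ?thesis by blast
qed

text \<open>The case of \<open>decorrelation\<close> in which \<open>v\<close> is the constant 1,
  whose variation is 0: all fibres of the projection have the same weight.\<close>

lemma avg_proj:
  assumes "n \<le> m"
  shows "avg (X m) (\<lambda>z. B (proj n z)) = avg (X n) B"
proof -
  obtain C where C: "\<And>B v \<eta> b. 0 \<le> \<eta> \<Longrightarrow> (\<forall>t\<in>T. avg (X m) (\<lambda>z. \<bar>v (t <# z) - v z\<bar>) \<le> \<eta>) \<Longrightarrow>
    (\<forall>y\<in>X n. \<bar>B y\<bar> \<le> b) \<Longrightarrow>
    \<bar>avg (X m) (\<lambda>z. B (proj n z) * v z) - avg (X n) B * avg (X m) v\<bar> \<le> C * b * \<eta>"
    using decorrelation[of n] assms by blast
  have "\<forall>y\<in>X n. \<bar>B y\<bar> \<le> (\<Sum>y\<in>X n. \<bar>B y\<bar>)" using fin by (auto intro!: member_le_sum)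
  then have "\<bar>avg (X m) (\<lambda>z. B (proj n z) * 1) - avg (X n) B * avg (X m) (\<lambda>_. 1)\<bar> \<le> 0"
    using C[of 0 "\<lambda>_. 1" B] by (simp add: avg_def)
  then show ?thesis using fin X_nonempty by (simp add: avg_const)
qed

text \<open>Here \<epsilon> bounds the displacement under the generators and \<delta> measures
  concentration: for a nonnegative function of mean square 1, a small mean forces most of the mean
  square to sit on a set of small density.\<close>

definition almost_invariant :: "nat \<Rightarrow> real \<Rightarrow> real \<Rightarrow> ('a set \<Rightarrow> real) \<Rightarrow> bool" where
  "almost_invariant n \<epsilon> \<delta> \<phi> \<longleftrightarrow> (\<forall>y. \<phi> y \<ge> 0) \<and> avg (X n) (\<lambda>y. (\<phi> y)\<^sup>2) = 1 \<and>
     (\<forall>t\<in>T. avg (X n) (\<lambda>y. (\<phi> (t <# y) - \<phi> y)\<^sup>2) \<le> \<epsilon>) \<and> (avg (X n) \<phi>)\<^sup>2 \<le> \<delta>"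

lemma almost_invariant_lift:
  assumes "n \<le> m" "almost_invariant n \<epsilon> \<delta> \<phi>"
  shows "almost_invariant m \<epsilon> \<delta> (\<lambda>z. \<phi> (proj n z))"
proof -
  have "avg (X m) (\<lambda>z. (\<phi> (proj n (t <# z)) - \<phi> (proj n z))\<^sup>2) =
      avg (X n) (\<lambda>y. (\<phi> (t <# y) - \<phi> y)\<^sup>2)" if "t \<in> T" for t
    using avg_proj[OF assms(1), of "\<lambda>y. (\<phi> (t <# y) - \<phi> y)\<^sup>2"]
    by (simp add: proj_act[OF assms(1) _ T_closed[OF that]] cong: avg_cong)
  moreover have "avg (X m) (\<lambda>z. (\<phi> (proj n z))\<^sup>2) = avg (X n) (\<lambda>y. (\<phi> y)\<^sup>2)"
    using avg_proj[OF assms(1)] .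
  ultimately show ?thesis
    using assms avg_proj[OF assms(1), of \<phi>] by (simp add: almost_invariant_def)
qed

text \<open>All the conditions are homogeneous of degree two, so dividing by the root mean square
  normalises them.\<close>

lemma almost_invariant_scale:
  assumes W: "avg (X n) (\<lambda>y. (\<phi> y)\<^sup>2) > 0" and "\<forall>y. \<phi> y \<ge> 0"
    and "\<forall>t\<in>T. avg (X n) (\<lambda>y. (\<phi> (t <# y) - \<phi> y)\<^sup>2) \<le> \<epsilon> * avg (X n) (\<lambda>y. (\<phi> y)\<^sup>2)"
    and "(avg (X n) \<phi>)\<^sup>2 \<le> \<delta> * avg (X n) (\<lambda>y. (\<phi> y)\<^sup>2)"
  shows "\<exists>\<psi>. almost_invariant n \<epsilon> \<delta> \<psi>"
proof -
  define W where "W = avg (X n) (\<lambda>y. (\<phi> y)\<^sup>2)"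
  have W0: "W > 0" and W1: "W \<noteq> 0" using W by (simp_all add: W_def)
  have sq: "(x / sqrt W)\<^sup>2 = (1/W) * x\<^sup>2" for x using W0 by (simp add: power_divide)
  have d: "\<phi> a / sqrt W - \<phi> b / sqrt W = (\<phi> a - \<phi> b) / sqrt W" for a b by (simp add: diff_divide_distrib)
  have a: "avg (X n) (\<lambda>y. \<phi> y / sqrt W) = avg (X n) \<phi> / sqrt W"
    using avg_cmult[of "X n" "1 / sqrt W" \<phi>] by simp
  have "almost_invariant n \<epsilon> \<delta> (\<lambda>y. \<phi> y / sqrt W)"
    unfolding almost_invariant_def d sq avg_cmult a using assms W0
    unfolding W_def[symmetric] by (auto simp: divide_le_eq)
  then show ?thesis by blast
qed

end

text \<open>Arcs carry their label, so distinct elements of \<open>S\<close> give distinct arcs: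
  multiplicities are counted and the out-degree is \<open>card S\<close>.\<close>

lemma markov_operator_schreier:
  assumes "X \<in> lcosets\<^bsub>G\<^esub> K"
  shows "markov_operator (schreier_graph G K S) f X = (\<Sum>s\<in>S. f (s <#\<^bsub>G\<^esub> X)) / real (card S)"
proof -
  have "out_arcs (schreier_graph G K S) X = Pair X ` S"
    using assms by (auto simp: out_arcs_def schreier_graph_def)
  then show ?thesis
    by (simp add: markov_operator_def out_degree_def card_image inj_on_def sum.reindex schreier_graph_def)
qed

lemma nontrivial_eigenvalue_schreier_iff:
  assumes "finite S" "S \<noteq> {}"
  shows "nontrivial_eigenvalue (schreier_graph G K S) \<mu> \<longleftrightarrow>
    (\<exists>f. (\<exists>X\<in>lcosets\<^bsub>G\<^esub> K. f X \<noteq> 0) \<and> (\<Sum>X\<in>lcosets\<^bsub>G\<^esub> K. f X) = 0 \<and>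
      (\<forall>X\<in>lcosets\<^bsub>G\<^esub> K. (\<Sum>s\<in>S. f (s <#\<^bsub>G\<^esub> X)) = \<mu> * real (card S) * f X))"
proof -
  have "verts (schreier_graph G K S) = lcosets\<^bsub>G\<^esub> K" by (simp add: schreier_graph_def)
  moreover have "real (card S) \<noteq> 0" using assms by simp
  then have "markov_operator (schreier_graph G K S) f X = \<mu> * f X \<longleftrightarrow>
      (\<Sum>s\<in>S. f (s <#\<^bsub>G\<^esub> X)) = \<mu> * real (card S) * f X" if "X \<in> lcosets\<^bsub>G\<^esub> K" for f X
    unfolding markov_operator_schreier[OF that] by (simp add: divide_eq_eq mult_ac)
  ultimately show ?thesis
    unfolding nontrivial_eigenvalue_def by simp
qed

section \<open>Amplifying concentration by products across levels\<close>

context subgroup_chain begin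

text \<open>A much deeper almost invariant function is nearly independent of the given one, so the
  product stays almost invariant and the two mean-to-norm ratios multiply.\<close>

lemma almost_invariant_product:
  assumes \<phi>: "\<And>\<epsilon>. \<epsilon> > 0 \<Longrightarrow> \<exists>n \<phi>. almost_invariant n \<epsilon> \<delta> \<phi>"
    and u: "\<And>\<epsilon>. \<epsilon> > 0 \<Longrightarrow> \<exists>n u. almost_invariant n \<epsilon> (1/2) u"
    and \<delta>: "\<delta> > 0" and \<epsilon>: "\<epsilon> > 0"
  shows "\<exists>n \<psi>. almost_invariant n \<epsilon> (3/4 * \<delta>) \<psi>"
proof -
  obtain n \<phi> where "almost_invariant n (\<epsilon>/16) \<delta> \<phi>"
    using \<phi>[of "\<epsilon>/16"] \<epsilon> by auto
  then have \<phi>0: "\<And>y. \<phi> y \<ge> 0" and \<phi>1: "avg (X n) (\<lambda>y. (\<phi> y)\<^sup>2) = 1"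
    and \<phi>2: "\<And>t. t \<in> T \<Longrightarrow> avg (X n) (\<lambda>y. (\<phi> (t <# y) - \<phi> y)\<^sup>2) \<le> \<epsilon>/16"
    and \<phi>3: "(avg (X n) \<phi>)\<^sup>2 \<le> \<delta>"
    by (simp_all add: almost_invariant_def)
  define b where "b = (\<Sum>y\<in>X n. \<phi> y)"
  have b: "\<phi> y \<le> b" if "y \<in> X n" for y
    unfolding b_def using that fin \<phi>0 by (intro member_le_sum) auto
  have b0: "b \<ge> 0" unfolding b_def using \<phi>0 by (intro sum_nonneg)
  \<comment> \<open>The order of choices matters: \<open>C\<close> and \<open>b\<close> depend only
    on the level \<open>n\<close> and on \<open>\<phi>\<close>, and the tolerance
    \<open>\<eta>\<close> for the deeper function is chosen after them.\<close>
  obtain C where C0: "C \<ge> 0" and C: "\<And>m B v \<eta> b. n \<le> m \<Longrightarrow> 0 \<le> \<eta> \<Longrightarrow>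
    (\<forall>t\<in>T. avg (X m) (\<lambda>z. \<bar>v (t <# z) - v z\<bar>) \<le> \<eta>) \<Longrightarrow> (\<forall>y\<in>X n. \<bar>B y\<bar> \<le> b) \<Longrightarrow>
    \<bar>avg (X m) (\<lambda>z. B (proj n z) * v z) - avg (X n) B * avg (X m) v\<bar> \<le> C * b * \<eta>"
    using decorrelation[of n] by blast
  \<comment> \<open>Exact independence would multiply \<delta> by 1/2. The weaker factor 3/4 leaves
    room for an error \<open>x > 0\<close> both in the mean and in the mean square of the
    product.\<close>
  have "((\<lambda>x. (sqrt \<delta> * sqrt (1/2) + x)\<^sup>2 - 3/4 * \<delta> * (1 - x)) \<longlongrightarrow>
      (sqrt \<delta> * sqrt (1/2) + 0)\<^sup>2 - 3/4 * \<delta> * (1 - 0)) (at_right 0)"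
    by (intro tendsto_intros)
  moreover have "(sqrt \<delta> * sqrt (1/2) + 0)\<^sup>2 - 3/4 * \<delta> * (1 - 0) < 0"
    using \<delta> by (simp add: power_mult_distrib real_sqrt_divide power_divide)
  ultimately have "\<forall>\<^sub>F x in at_right 0. (sqrt \<delta> * sqrt (1/2) + x)\<^sup>2 - 3/4 * \<delta> * (1 - x) < 0"
    by (rule order_tendstoD(2))
  moreover have "\<forall>\<^sub>F x in at_right (0::real). 0 < x \<and> x < 1/2"
    unfolding eventually_at_right_field by (rule exI[of _ "1/2"]) auto
  ultimately have "\<forall>\<^sub>F x in at_right 0. (sqrt \<delta> * sqrt (1/2) + x)\<^sup>2 - 3/4 * \<delta> * (1 - x) < 0 \<and> 0 < x \<and> x < 1/2"
    by eventually_elim auto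
  then obtain x where x: "(sqrt \<delta> * sqrt (1/2) + x)\<^sup>2 < 3/4 * \<delta> * (1 - x)" "0 < x" "x < 1/2"
    using eventually_happens'[OF trivial_limit_at_right_real] by fastforce
  have small: "\<forall>\<^sub>F \<eta> in at_right 0. c * sqrt \<eta> + d * \<eta> < e" if "e > 0" for c d e :: real
  proof -
    have "((\<lambda>\<eta>. c * sqrt \<eta> + d * \<eta>) \<longlongrightarrow> c * sqrt 0 + d * 0) (at_right 0)"
      by (intro tendsto_intros)
    then show ?thesis by (rule order_tendstoD(2)) (use that in simp)
  qed
  have "\<forall>\<^sub>F \<eta> in at_right 0. C * b * sqrt \<eta> + 0 * \<eta> < x \<and> C * b\<^sup>2 * 2 * sqrt \<eta> + 0 * \<eta> < min x (\<epsilon>/16)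
      \<and> 0 * sqrt \<eta> + 2 * b\<^sup>2 * \<eta> < \<epsilon>/16 \<and> 0 < \<eta>"
    using x \<epsilon> by (intro eventually_conj small eventually_at_right_less) auto
  then obtain \<eta> where "C * b * sqrt \<eta> + 0 * \<eta> < x \<and> C * b\<^sup>2 * 2 * sqrt \<eta> + 0 * \<eta> < min x (\<epsilon>/16)
      \<and> 0 * sqrt \<eta> + 2 * b\<^sup>2 * \<eta> < \<epsilon>/16 \<and> 0 < \<eta>"
    using eventually_happens'[OF trivial_limit_at_right_real] by blast
  \<comment> \<open>After positivity, the bounds serve in order the mean of the product, its mean
    square, the displacement coming from \<open>\<phi>\<close>, and the displacement coming from
    \<open>u\<close>. The summands with coefficient 0 above only bring each bound to the shape of
    \<open>small\<close>.\<close>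
  then have \<eta>: "\<eta> > 0" "C * b * sqrt \<eta> < x" "C * b\<^sup>2 * (2 * sqrt \<eta>) < x"
      "C * b\<^sup>2 * (2 * sqrt \<eta>) < \<epsilon>/16" "2 * b\<^sup>2 * \<eta> < \<epsilon>/16"
    by (auto simp: mult_ac)
  obtain m0 u0 where "almost_invariant m0 \<eta> (1/2) u0" using u \<eta>(1) by blast
  \<comment> \<open>Lifting \<open>u0\<close> to a level below \<open>n\<close> in the chain makes
    \<open>decorrelation\<close> applicable; the lift keeps all its parameters.\<close>
  define m where "m = max n m0"
  define u where "u z = u0 (proj m0 z)" for z
  have m: "n \<le> m" by (simp add: m_def)
  have "almost_invariant m \<eta> (1/2) u"
    unfolding u_def by (rule almost_invariant_lift) (simp_all add: m_def \<open>almost_invariant m0 \<eta> (1/2) u0\<close>)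
  then have u0: "\<And>y. u y \<ge> 0" and u1: "avg (X m) (\<lambda>y. (u y)\<^sup>2) = 1"
    and u2: "\<And>t. t \<in> T \<Longrightarrow> avg (X m) (\<lambda>y. (u (t <# y) - u y)\<^sup>2) \<le> \<eta>"
    and u3: "(avg (X m) u)\<^sup>2 \<le> 1/2"
    by (simp_all add: almost_invariant_def)
  \<comment> \<open>The hypothesis of \<open>decorrelation\<close> is an L1 variation;
    Cauchy-Schwarz supplies it for \<open>u\<close>, and for the square of \<open>u\<close> after
    factoring the difference of squares.\<close>
  have v1: "\<forall>t\<in>T. avg (X m) (\<lambda>z. \<bar>u (t <# z) - u z\<bar>) \<le> sqrt \<eta>"
  proof
    fix t assume t: "t \<in> T"
    have "(avg (X m) (\<lambda>z. \<bar>u (t <# z) - u z\<bar>))\<^sup>2 \<le> \<eta>"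
      using avg_square_le[OF fin, of m "\<lambda>z. \<bar>u (t <# z) - u z\<bar>"] u2[OF t] by simp
    then show "avg (X m) (\<lambda>z. \<bar>u (t <# z) - u z\<bar>) \<le> sqrt \<eta>" by (rule real_le_rsqrt)
  qed
  have v2: "\<forall>t\<in>T. avg (X m) (\<lambda>z. \<bar>(u (t <# z))\<^sup>2 - (u z)\<^sup>2\<bar>) \<le> 2 * sqrt \<eta>"
  proof
    fix t assume t: "t \<in> T"
    have "avg (X m) (\<lambda>z. (u (t <# z) + u z)\<^sup>2) \<le> avg (X m) (\<lambda>z. 2 * (u (t <# z))\<^sup>2 + 2 * (u z)\<^sup>2)"
    proof (rule avg_mono)
      show "(u (t <# z) + u z)\<^sup>2 \<le> 2 * (u (t <# z))\<^sup>2 + 2 * (u z)\<^sup>2" for z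
        using sum_squares_bound[of "u (t <# z)" "u z"] by (simp add: power2_sum)
    qed
    also have "\<dots> = 4"
      using avg_act[OF T_closed[OF t], of m "\<lambda>z. (u z)\<^sup>2"] u1 by (simp add: avg_add avg_cmult)
    finally have 4: "avg (X m) (\<lambda>z. (u (t <# z) + u z)\<^sup>2) \<le> 4" .
    have "(avg (X m) (\<lambda>z. \<bar>(u (t <# z))\<^sup>2 - (u z)\<^sup>2\<bar>))\<^sup>2
        = (avg (X m) (\<lambda>z. \<bar>u (t <# z) - u z\<bar> * (u (t <# z) + u z)))\<^sup>2"
    proof -
      have "\<bar>a\<^sup>2 - c\<^sup>2\<bar> = \<bar>a - c\<bar> * (a + c)" if "0 \<le> a" "0 \<le> c" for a c :: real
        using that by (simp add: power2_eq_square square_diff_square_factored abs_mult)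
      then show ?thesis using u0 by simp
    qed
    also have "\<dots> \<le> avg (X m) (\<lambda>z. (u (t <# z) - u z)\<^sup>2) * avg (X m) (\<lambda>z. (u (t <# z) + u z)\<^sup>2)"
      using avg_Cauchy_Schwarz[of "X m" "\<lambda>z. \<bar>u (t <# z) - u z\<bar>"] by simp
    also have "\<dots> \<le> \<eta> * 4"
      using u2[OF t] 4 \<eta>(1) by (intro mult_mono avg_nonneg) auto
    also have "\<dots> = (2 * sqrt \<eta>)\<^sup>2" using \<eta>(1) by (simp add: power_mult_distrib)
    finally show "avg (X m) (\<lambda>z. \<bar>(u (t <# z))\<^sup>2 - (u z)\<^sup>2\<bar>) \<le> 2 * sqrt \<eta>"
      by (rule power2_le_imp_le) (use \<eta>(1) in simp)
  qed
  define \<Phi> where "\<Phi> z = \<phi> (proj n z) * u z" for z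
  define W where "W = avg (X m) (\<lambda>z. (\<Phi> z)\<^sup>2)"
  have sq_bound: "\<bar>(\<phi> y)\<^sup>2\<bar> \<le> b\<^sup>2" if "y \<in> X n" for y
    using b[OF that] \<phi>0[of y] by (simp add: power_mono)
  have diff_bound: "\<bar>(\<phi> (t <# y) - \<phi> y)\<^sup>2\<bar> \<le> b\<^sup>2" if "y \<in> X n" "t \<in> T" for t y
  proof -
    have "\<bar>\<phi> (t <# y) - \<phi> y\<bar> \<le> b"
      using b[OF that(1)] b[OF act_closed[OF that(1) T_closed[OF that(2)]]] \<phi>0[of y] \<phi>0[of "t <# y"]
      by linarith
    then have "\<bar>\<phi> (t <# y) - \<phi> y\<bar>\<^sup>2 \<le> b\<^sup>2" by (rule power_mono) simp
    then show ?thesis by simp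
  qed
  \<comment> \<open>The square of \<open>\<phi>\<close> decorrelates from the square of
    \<open>u\<close>, so the product has mean square close to 1.\<close>
  have "\<bar>W - avg (X n) (\<lambda>y. (\<phi> y)\<^sup>2) * avg (X m) (\<lambda>y. (u y)\<^sup>2)\<bar> \<le> C * b\<^sup>2 * (2 * sqrt \<eta>)"
    unfolding W_def \<Phi>_def power_mult_distrib
    by (rule C[OF m _ v2, where B="\<lambda>y. (\<phi> y)\<^sup>2"]) (use \<eta>(1) sq_bound in auto)
  then have W: "W \<ge> 1 - x" using \<eta>(3) unfolding \<phi>1 u1 by linarith
  have "\<bar>avg (X m) \<Phi> - avg (X n) \<phi> * avg (X m) u\<bar> \<le> C * b * sqrt \<eta>"
    unfolding \<Phi>_def by (rule C[OF m _ v1]) (use \<eta>(1) b \<phi>0 in auto)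
  moreover have "avg (X n) \<phi> * avg (X m) u \<le> sqrt \<delta> * sqrt (1/2)"
    using \<phi>3 u3 u0 \<phi>0 \<delta> by (intro mult_mono real_le_rsqrt avg_nonneg) auto
  ultimately have "avg (X m) \<Phi> \<le> sqrt \<delta> * sqrt (1/2) + x" using \<eta>(2) by linarith
  moreover have "avg (X m) \<Phi> \<ge> 0" unfolding \<Phi>_def using u0 \<phi>0 by (intro avg_nonneg) auto
  ultimately have "(avg (X m) \<Phi>)\<^sup>2 \<le> (sqrt \<delta> * sqrt (1/2) + x)\<^sup>2" by (rule power_mono)
  also have "\<dots> \<le> 3/4 * \<delta> * (1 - x)" using x(1) by simp
  also have "\<dots> \<le> 3/4 * \<delta> * W" using W \<delta> by (intro mult_left_mono) auto
  finally have ratio: "(avg (X m) \<Phi>)\<^sup>2 \<le> 3/4 * \<delta> * W" .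
  have inv: "avg (X m) (\<lambda>z. (\<Phi> (t <# z) - \<Phi> z)\<^sup>2) \<le> \<epsilon> * W" if t: "t \<in> T" for t
  proof -
    \<comment> \<open>A product rule splits the displacement of the product into
      \<open>\<phi>\<close> times that of \<open>u\<close>, bounded through \<open>b\<close>, and
      \<open>u\<close> times that of \<open>\<phi>\<close>. In the second term \<open>d\<close> is
      again a function at level \<open>n\<close> and decorrelates from the square of
      \<open>u\<close>. Together they stay below \<open>\<epsilon>/2\<close>, while \<open>W\<close>
      exceeds 1/2.\<close>
    define d where "d y = (\<phi> (t <# y) - \<phi> y)\<^sup>2" for y
    have "(\<Phi> (t <# z) - \<Phi> z)\<^sup>2 \<le> 2 * b\<^sup>2 * (u (t <# z) - u z)\<^sup>2 + 2 * (d (proj n z) * (u z)\<^sup>2)"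
      if z: "z \<in> X m" for z
    proof -
      let ?p = "\<phi> (t <# proj n z)"
      have py: "t <# proj n z \<in> X n"
        by (rule act_closed[OF proj_closed[OF m z] T_closed[OF t]])
      have "\<Phi> (t <# z) - \<Phi> z = ?p * (u (t <# z) - u z) + (?p - \<phi> (proj n z)) * u z"
        by (simp add: \<Phi>_def proj_act[OF m z T_closed[OF t]] algebra_simps)
      also have "\<dots>\<^sup>2 \<le> 2 * (?p * (u (t <# z) - u z))\<^sup>2 + 2 * ((?p - \<phi> (proj n z)) * u z)\<^sup>2"
        using sum_squares_bound[of "?p * (u (t <# z) - u z)" "(?p - \<phi> (proj n z)) * u z"]
        by (simp add: power2_sum)
      also have "\<dots> = 2 * (?p\<^sup>2 * (u (t <# z) - u z)\<^sup>2) + 2 * (d (proj n z) * (u z)\<^sup>2)"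
        by (simp only: d_def power_mult_distrib)
      also have "?p\<^sup>2 * (u (t <# z) - u z)\<^sup>2 \<le> b\<^sup>2 * (u (t <# z) - u z)\<^sup>2"
        using sq_bound[OF py] by (intro mult_right_mono) auto
      finally show ?thesis by simp
    qed
    then have "avg (X m) (\<lambda>z. (\<Phi> (t <# z) - \<Phi> z)\<^sup>2)
        \<le> avg (X m) (\<lambda>z. 2 * b\<^sup>2 * (u (t <# z) - u z)\<^sup>2 + 2 * (d (proj n z) * (u z)\<^sup>2))"
      by (rule avg_mono)
    also have "\<dots> = 2 * b\<^sup>2 * avg (X m) (\<lambda>z. (u (t <# z) - u z)\<^sup>2) + 2 * avg (X m) (\<lambda>z. d (proj n z) * (u z)\<^sup>2)"
      by (simp only: avg_add avg_cmult)
    also have "2 * b\<^sup>2 * avg (X m) (\<lambda>z. (u (t <# z) - u z)\<^sup>2) \<le> 2 * b\<^sup>2 * \<eta>"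
      using u2[OF t] by (intro mult_left_mono) auto
    also have "avg (X m) (\<lambda>z. d (proj n z) * (u z)\<^sup>2) \<le> \<epsilon>/16 + \<epsilon>/16"
    proof -
      have "\<bar>avg (X m) (\<lambda>z. d (proj n z) * (u z)\<^sup>2) - avg (X n) d * avg (X m) (\<lambda>z. (u z)\<^sup>2)\<bar>
          \<le> C * b\<^sup>2 * (2 * sqrt \<eta>)"
        by (rule C[OF m _ v2]) (use \<eta>(1) diff_bound[OF _ t] in \<open>auto simp: d_def\<close>)
      moreover have "avg (X n) d \<le> \<epsilon>/16" using \<phi>2[OF t] by (simp add: d_def[abs_def])
      ultimately show ?thesis using \<eta>(4) unfolding u1 by linarith
    qed
    also have "2 * b\<^sup>2 * \<eta> + 2 * (\<epsilon>/16 + \<epsilon>/16) \<le> \<epsilon> * (1/2)"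
    proof -
      have "a + 2 * (e/16 + e/16) \<le> e * (1/2)" if "a < e/16" "0 < e" for a e :: real
        using that by simp
      then show ?thesis using \<eta>(5) \<epsilon> by blast
    qed
    also have "\<dots> \<le> \<epsilon> * W" using W x(3) \<epsilon> by (intro mult_left_mono) auto
    finally show ?thesis by simp
  qed
  have "\<forall>z. \<Phi> z \<ge> 0" using u0 \<phi>0 by (simp add: \<Phi>_def)
  then have "\<exists>\<psi>. almost_invariant m \<epsilon> (3/4 * \<delta>) \<psi>"
    using W x(3) inv ratio
    by (intro almost_invariant_scale[of m \<Phi>]) (simp_all add: W_def[symmetric])
  then show ?thesis by blast
qed

text \<open>A positive or negative part of an almost invariant zero-sum function gives concentration
  1/2; each further product gains a factor 3/4, which after finitely many rounds beats any
  \<delta>.\<close>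

lemma almost_invariant_concentrated:
  assumes ev: "\<And>\<epsilon>. \<epsilon> > 0 \<Longrightarrow> \<exists>n (f :: 'a set \<Rightarrow> real). (\<exists>z\<in>X n. f z \<noteq> 0) \<and> (\<Sum>z\<in>X n. f z) = 0 \<and>
    (\<forall>t\<in>T. (\<Sum>z\<in>X n. (f (t <# z) - f z)\<^sup>2) \<le> \<epsilon> * (\<Sum>z\<in>X n. (f z)\<^sup>2))"
    and "\<delta> > 0" "\<epsilon> > 0"
  shows "\<exists>n \<phi>. almost_invariant n \<epsilon> \<delta> \<phi>"
proof -
  have base: "\<exists>n \<phi>. almost_invariant n \<epsilon> (1/2) \<phi>" if \<epsilon>: "\<epsilon> > 0" for \<epsilon> :: real
  proof -
    \<comment> \<open>The factor 1/3 compensates for the chosen part, which may retain only a third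
      of the mean square.\<close>
    obtain n f where f: "\<exists>z\<in>X n. f z \<noteq> 0" "(\<Sum>z\<in>X n. f z) = 0"
      "\<And>t. t \<in> T \<Longrightarrow> (\<Sum>z\<in>X n. (f (t <# z) - f z)\<^sup>2) \<le> \<epsilon>/3 * (\<Sum>z\<in>X n. (f z)\<^sup>2)"
      using ev[of "\<epsilon>/3"] \<epsilon> by auto
    have N: "real (card (X n)) > 0" using fin X_nonempty by (simp add: card_gt_0_iff)
    define W where "W = avg (X n) (\<lambda>z. (f z)\<^sup>2)"
    have "(\<Sum>z\<in>X n. (f z)\<^sup>2) > 0"
      using f(1) fin by (meson sum_pos2 zero_le_power2 zero_less_power2)
    then have W: "W > 0" using N by (simp add: W_def avg_def)
    define g where "g z = f z / sqrt W" for z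
    have gsq: "avg (X n) (\<lambda>z. (f' z / sqrt W)\<^sup>2) = avg (X n) (\<lambda>z. (f' z)\<^sup>2) / W" for f'
      using W avg_cmult[of "X n" "1/W" "\<lambda>z. (f' z)\<^sup>2"] by (simp add: power_divide)
    have g0: "avg (X n) g = 0"
      using f(2) by (simp add: avg_def g_def flip: sum_divide_distrib)
    have g1: "avg (X n) (\<lambda>z. (g z)\<^sup>2) = 1"
      using W gsq[of f] by (simp add: g_def W_def)
    have g2: "avg (X n) (\<lambda>z. (g (t <# z) - g z)\<^sup>2) \<le> \<epsilon>/3" if "t \<in> T" for t
    proof -
      have "avg (X n) (\<lambda>z. (f (t <# z) - f z)\<^sup>2) \<le> \<epsilon>/3 * W"
        using divide_right_mono[OF f(3)[OF that], of "real (card (X n))"] by (simp add: W_def avg_def)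
      then show ?thesis
        using gsq[of "\<lambda>z. f (t <# z) - f z"] W
        by (simp add: g_def pos_divide_le_eq flip: diff_divide_distrib)
    qed
    obtain \<sigma> where \<sigma>: "\<sigma> \<in> {1,-1}" "avg (X n) (\<lambda>x. (max 0 (\<sigma> * g x))\<^sup>2) \<ge> 1/3"
      "(avg (X n) (\<lambda>x. max 0 (\<sigma> * g x)))\<^sup>2 \<le> 1/2 * avg (X n) (\<lambda>x. (max 0 (\<sigma> * g x))\<^sup>2)"
      using zero_mean_half_concentrated[OF fin g0 g1] by blast
    have "avg (X n) (\<lambda>z. (max 0 (\<sigma> * g (t <# z)) - max 0 (\<sigma> * g z))\<^sup>2)
        \<le> \<epsilon> * avg (X n) (\<lambda>x. (max 0 (\<sigma> * g x))\<^sup>2)" if "t \<in> T" for t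
    proof -
      \<comment> \<open>Taking positive parts is 1-Lipschitz, so it does not increase
        displacements.\<close>
      have "(max 0 (\<sigma> * g (t <# z)) - max 0 (\<sigma> * g z))\<^sup>2 \<le> (g (t <# z) - g z)\<^sup>2" for z
        by (rule abs_le_square_iff[THEN iffD1]) (use \<sigma>(1) in \<open>auto simp: max_def\<close>)
      then have "avg (X n) (\<lambda>z. (max 0 (\<sigma> * g (t <# z)) - max 0 (\<sigma> * g z))\<^sup>2)
          \<le> avg (X n) (\<lambda>z. (g (t <# z) - g z)\<^sup>2)" by (intro avg_mono)
      also have "\<dots> \<le> \<epsilon> * (1/3)" using g2[OF that] by simp
      also have "\<dots> \<le> \<epsilon> * avg (X n) (\<lambda>x. (max 0 (\<sigma> * g x))\<^sup>2)"
        using \<sigma>(2) \<epsilon> by (intro mult_left_mono) auto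
      finally show ?thesis .
    qed
    then have "\<exists>\<psi>. almost_invariant n \<epsilon> (1/2) \<psi>"
      using \<sigma>(2,3) by (intro almost_invariant_scale[of n "\<lambda>x. max 0 (\<sigma> * g x)"]) auto
    then show ?thesis by blast
  qed
  have pow: "\<epsilon> > 0 \<Longrightarrow> \<exists>n \<phi>. almost_invariant n \<epsilon> ((3/4)^k * (1/2)) \<phi>" for k and \<epsilon> :: real
  proof (induction k arbitrary: \<epsilon>)
    case 0
    then show ?case using base by simp
  next
    case (Suc k)
    have "\<exists>n \<psi>. almost_invariant n \<epsilon> (3/4 * ((3/4)^k * (1/2))) \<psi>"
      by (rule almost_invariant_product[OF Suc.IH base _ Suc.prems]) simp_all
    then show ?case by (simp add: mult_ac)
  qed
  obtain k where "(3/4::real)^k < \<delta>" using real_arch_pow_inv[OF \<open>\<delta> > 0\<close>, of "3/4"] by auto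
  moreover have "(3/4::real)^k * (1/2) \<le> (3/4)^k" by simp
  ultimately have "(3/4)^k * (1/2) \<le> \<delta>" by linarith
  with pow[OF \<open>\<epsilon> > 0\<close>, of k] show ?thesis
    unfolding almost_invariant_def by (meson order_trans)
qed

text \<open>For an eigenfunction with eigenvalue \<mu>, the squared displacements summed over
  \<open>T\<close> equal \<open>2 * card T * (1 - \<mu>)\<close> times the squared norm. Each
  generator contributes at most the whole sum, which explains the choice of
  \<open>\<eta>\<close>.\<close>

lemma nontrivial_eigenvalue_near_one:
  assumes T: "T \<noteq> {}" and SUP: "\<not> (SUP n. rho_plus (schreier_graph G (L n) T)) < 1" and \<epsilon>: "\<epsilon> > 0"
  shows "\<exists>n (f :: 'a set \<Rightarrow> real). (\<exists>z\<in>X n. f z \<noteq> 0) \<and> (\<Sum>z\<in>X n. f z) = 0 \<and>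
    (\<forall>t\<in>T. (\<Sum>z\<in>X n. (f (t <# z) - f z)\<^sup>2) \<le> \<epsilon> * (\<Sum>z\<in>X n. (f z)\<^sup>2))"
proof -
  define d where "d = real (card T)"
  have d: "d > 0" using T T_fin by (simp add: d_def card_gt_0_iff)
  define \<eta> where "\<eta> = \<epsilon> / (2 * d)"
  have \<eta>: "\<eta> > 0" using d \<epsilon> by (simp add: \<eta>_def)
  have "ereal (1 - \<eta>) < (SUP n. rho_plus (schreier_graph G (L n) T))"
    using SUP \<eta> by (metis ereal_less(3) less_le_trans linorder_not_less diff_less_eq less_add_same_cancel1
        ereal_less_eq(3) one_ereal_def less_ereal.simps(1))
  then obtain n where "ereal (1 - \<eta>) < rho_plus (schreier_graph G (L n) T)"
    by (auto simp: less_SUP_iff)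
  then obtain \<mu> where \<mu>: "1 - \<eta> < \<mu>" "nontrivial_eigenvalue (schreier_graph G (L n) T) \<mu>"
    unfolding rho_plus_def by (auto simp: less_Sup_iff)
  then obtain f where f: "\<exists>z\<in>X n. f z \<noteq> 0" "(\<Sum>z\<in>X n. f z) = 0"
    "\<And>z. z \<in> X n \<Longrightarrow> (\<Sum>t\<in>T. f (t <# z)) = \<mu> * d * f z"
    unfolding nontrivial_eigenvalue_schreier_iff[OF T_fin T] d_def by blast
  define W where "W = (\<Sum>z\<in>X n. (f z)\<^sup>2)"
  have W: "W \<ge> 0" unfolding W_def by (intro sum_nonneg) simp
  have tr: "(\<Sum>z\<in>X n. v (t <# z)) = (\<Sum>z\<in>X n. v z)" if "t \<in> T" for t and v :: "'a set \<Rightarrow> real"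
    using sum.reindex_bij_betw[OF lcosets_act_bij[OF sub T_closed[OF that]]] .
  have "(\<Sum>t\<in>T. \<Sum>z\<in>X n. (f (t <# z) - f z)\<^sup>2)
      = (\<Sum>t\<in>T. 2 * W - 2 * (\<Sum>z\<in>X n. f (t <# z) * f z))"
  proof (intro sum.cong refl)
    fix t assume t: "t \<in> T"
    show "(\<Sum>z\<in>X n. (f (t <# z) - f z)\<^sup>2) = 2 * W - 2 * (\<Sum>z\<in>X n. f (t <# z) * f z)"
      using tr[OF t, of "\<lambda>z. (f z)\<^sup>2"]
      by (simp add: W_def power2_diff sum_subtractf sum.distrib sum_distrib_left mult.assoc)
  qed
  also have "\<dots> = 2 * d * W - 2 * (\<Sum>z\<in>X n. (\<Sum>t\<in>T. f (t <# z)) * f z)"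
  proof -
    have "(\<Sum>t\<in>T. \<Sum>z\<in>X n. f (t <# z) * f z) = (\<Sum>z\<in>X n. (\<Sum>t\<in>T. f (t <# z)) * f z)"
      unfolding sum_distrib_right by (rule sum.swap)
    then show ?thesis by (simp add: sum_subtractf d_def flip: sum_distrib_left)
  qed
  also have "(\<Sum>z\<in>X n. (\<Sum>t\<in>T. f (t <# z)) * f z) = \<mu> * d * W"
    unfolding W_def sum_distrib_left by (intro sum.cong refl) (simp add: f(3) power2_eq_square)
  also have "2 * d * W - 2 * (\<mu> * d * W) = (1 - \<mu>) * (2 * d * W)" by (simp add: algebra_simps)
  also have "\<dots> \<le> \<eta> * (2 * d * W)" using \<mu>(1) d W by (intro mult_right_mono) auto
  also have "\<dots> = \<epsilon> * W" using d by (simp add: \<eta>_def)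
  finally have total: "(\<Sum>t\<in>T. \<Sum>z\<in>X n. (f (t <# z) - f z)\<^sup>2) \<le> \<epsilon> * W" .
  have "(\<Sum>z\<in>X n. (f (t <# z) - f z)\<^sup>2) \<le> \<epsilon> * W" if "t \<in> T" for t
    using member_le_sum[OF that, of "\<lambda>t. \<Sum>z\<in>X n. (f (t <# z) - f z)\<^sup>2"] T_fin total
    by (simp add: sum_nonneg)
  then show ?thesis using f(1,2) by (auto simp: W_def)
qed

end

subsection \<open>Schreier graphs and the relative spectral radius\<close>

lemma symmetric_generating_set_inv:
  assumes "symmetric_generating_set S G" "s \<in> S"
  shows "inv\<^bsub>G\<^esub> s \<in> S"
  using assms unfolding symmetric_generating_set_def SET_INV_def by blast

context group begin

text \<open>Finite index is counted with right cosets while Schreier graphs live on left cosets;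
  inversion carries \<open>K #> inv a\<close> onto \<open>a <# K\<close>.\<close>

lemma finite_lcosets:
  assumes "subgroup K G" "finite (rcosets K)"
  shows "finite (lcosets K)"
proof -
  have "a <# K = (\<lambda>x. inv x) ` (K #> inv a)" if a: "a \<in> carrier G" for a
  proof
    have "\<exists>k'\<in>K. a \<otimes> k = inv (k' \<otimes> inv a)" if k: "k \<in> K" for k
      using a k subgroup.mem_carrier[OF assms(1) k]
      by (intro bexI[of _ "inv k"]) (simp_all add: inv_mult_group subgroup.m_inv_closed[OF assms(1)])
    then show "a <# K \<subseteq> (\<lambda>x. inv x) ` (K #> inv a)"
      by (fastforce simp: l_coset_def r_coset_def)
    have "inv (k \<otimes> inv a) = a \<otimes> inv k" if k: "k \<in> K" for k
      using a subgroup.mem_carrier[OF assms(1) k] by (simp add: inv_mult_group)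
    then show "(\<lambda>x. inv x) ` (K #> inv a) \<subseteq> a <# K"
      using subgroup.m_inv_closed[OF assms(1)] by (auto simp: l_coset_def r_coset_def)
  qed
  then have "lcosets K \<subseteq> (\<lambda>Y. (\<lambda>x. inv x) ` Y) ` (rcosets K)"
    unfolding LCOSETS_def RCOSETS_def by blast
  then show ?thesis using assms(2) by (meson finite_imageI finite_subset)
qed

text \<open>Apply \<open>zero_sum_quadratic_form_le\<close> to the matrix counting arcs between
  vertices. It is symmetric because \<open>s\<close> and \<open>inv s\<close> label opposite arcs,
  its rows sum to \<open>card S\<close>, and its eigenvalues are \<open>card S\<close> times those
  of the Markov operator.\<close>

lemma schreier_quadratic_form_le:
  assumes S: "symmetric_generating_set S G" "S \<noteq> {}"
    and K: "subgroup K G" and fin: "finite (lcosets K)"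
    and rho: "rho_plus (schreier_graph G K S) < ereal r"
    and zs: "(\<Sum>z\<in>lcosets K. \<theta> z) = 0"
  shows "(\<Sum>s\<in>S. \<Sum>z\<in>lcosets K. \<theta> (s <# z) * \<theta> z) \<le> r * real (card S) * (\<Sum>z\<in>lcosets K. (\<theta> z)\<^sup>2)"
proof -
  have finS: "finite S" and SG: "S \<subseteq> carrier G"
    using S(1) by (auto simp: symmetric_generating_set_def)
  define Z where "Z = lcosets K"
  define a where "a x y = real (card {s\<in>S. s <# x = y})" for x y
  have d: "real (card S) > 0" using finS S(2) by (simp add: card_gt_0_iff)
  have conv: "(\<Sum>y\<in>Z. a x y * v y) = (\<Sum>s\<in>S. v (s <# x))" if x: "x \<in> Z" for x and v :: "'a set \<Rightarrow> real"
  proof -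
    have "(\<Sum>y\<in>Z. a x y * v y) = (\<Sum>y\<in>Z. \<Sum>s\<in>{s\<in>S. s <# x = y}. v (s <# x))"
      by (intro sum.cong refl) (simp add: a_def)
    also have "\<dots> = (\<Sum>s\<in>S. v (s <# x))"
      using x SG lcosets_act_closed[OF K] fin finS by (intro sum.group) (auto simp: Z_def)
    finally show ?thesis .
  qed
  have "(\<Sum>x\<in>Z. \<Sum>y\<in>Z. a x y * \<theta> y * \<theta> x) \<le> (r * real (card S)) * (\<Sum>x\<in>Z. (\<theta> x)\<^sup>2)"
  proof (rule zero_sum_quadratic_form_le)
    show "finite Z" using fin by (simp add: Z_def)
    show "(\<Sum>x\<in>Z. \<theta> x) = 0" using zs by (simp add: Z_def)
    show "(\<Sum>y\<in>Z. a x y) = real (card S)" if "x \<in> Z" for x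
      using conv[OF that, of "\<lambda>_. 1"] by simp
    show "a x y = a y x" if xy: "x \<in> Z" "y \<in> Z" for x y
    proof -
      have inv: "inv s <# (s <# z) = z" "s <# (inv s <# z) = z" if "s \<in> S" "z \<in> Z" for s z
        using lcosets_act_inv[OF K] that SG by (auto simp: Z_def)
      have flip: "inv s \<in> {s\<in>S. s <# v = u}" if "s \<in> {s\<in>S. s <# u = v}" "u \<in> Z" for s u v
        using that inv(1) symmetric_generating_set_inv[OF S(1)] by auto
      have "bij_betw (\<lambda>s. inv s) {s\<in>S. s <# x = y} {s\<in>S. s <# y = x}"
      proof (rule bij_betwI[of _ _ _ "\<lambda>s. inv s"])
        show "(\<lambda>s. inv s) \<in> {s\<in>S. s <# x = y} \<rightarrow> {s\<in>S. s <# y = x}"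
          "(\<lambda>s. inv s) \<in> {s\<in>S. s <# y = x} \<rightarrow> {s\<in>S. s <# x = y}"
          using flip xy by blast+
        show "inv (inv s) = s" if "s \<in> {s\<in>S. s <# x = y}" for s
          using that SG by (intro inv_inv) blast
        show "inv (inv s) = s" if "s \<in> {s\<in>S. s <# y = x}" for s
          using that SG by (intro inv_inv) blast
      qed
      then show ?thesis unfolding a_def by (simp only: bij_betw_same_card)
    qed
  next
    fix \<mu> f
    assume f: "\<exists>x\<in>Z. f x \<noteq> 0" "(\<Sum>x\<in>Z. f x) = 0" "\<forall>x\<in>Z. (\<Sum>y\<in>Z. a x y * f y) = \<mu> * f x"
    then have "nontrivial_eigenvalue (schreier_graph G K S) (\<mu> / real (card S))"
      unfolding nontrivial_eigenvalue_schreier_iff[OF finS S(2)] using d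
      by (intro exI[of _ f]) (auto simp: Z_def[symmetric] conv)
    then have "ereal (\<mu> / real (card S)) \<le> rho_plus (schreier_graph G K S)"
      unfolding rho_plus_def by (intro Sup_upper) auto
    then have "ereal (\<mu> / real (card S)) < ereal r" using rho by (rule le_less_trans)
    then show "\<mu> \<le> r * real (card S)" using d by (simp add: field_simps)
  qed
  also have "(\<Sum>x\<in>Z. \<Sum>y\<in>Z. a x y * \<theta> y * \<theta> x) = (\<Sum>x\<in>Z. \<Sum>s\<in>S. \<theta> (s <# x) * \<theta> x)"
  proof (intro sum.cong refl)
    fix x assume "x \<in> Z"
    then show "(\<Sum>y\<in>Z. a x y * \<theta> y * \<theta> x) = (\<Sum>s\<in>S. \<theta> (s <# x) * \<theta> x)"
      using conv[of x \<theta>] by (metis sum_distrib_right)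
  qed
  also have "\<dots> = (\<Sum>s\<in>S. \<Sum>x\<in>Z. \<theta> (s <# x) * \<theta> x)" by (rule sum.swap)
  finally show ?thesis by (simp add: Z_def)
qed

lemma rcosets_act_bij:
  assumes "subgroup H G" "s \<in> carrier G"
  shows "bij_betw (\<lambda>Y. Y #> s) (rcosets H) (rcosets H)"
proof -
  have "Y #> s \<in> rcosets H" if "Y \<in> rcosets H" "s \<in> carrier G" for Y s
    using that assms(1) by (auto simp: RCOSETS_def coset_mult_assoc subgroup.subset)
  moreover have "Y #> s #> inv s = Y" "Y #> inv s #> s = Y" if "Y \<in> rcosets H" for Y
    using subgroup.rcosets_carrier[OF assms(1) is_group that] assms(2) by (simp_all add: coset_mult_assoc)
  ultimately show ?thesis
    using assms(2) by (intro bij_betwI[of _ _ _ "\<lambda>Y. Y #> inv s"]) auto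
qed

text \<open>The supremum exceeds \<open>r\<close>, so some square-summable function has Rayleigh
  quotient above \<open>r\<close>; for the uniform measure its form is a finite sum of translation
  correlations, which can be truncated.\<close>

lemma relative_spectral_radius_finite_witness:
  assumes S: "finite S" "S \<noteq> {}" "S \<subseteq> carrier G" and H: "subgroup H G"
    and r: "ereal r < relative_spectral_radius G H (pmf_of_set S)"
  obtains f F where "finite F" "F \<subseteq> rcosets H"
    "(\<Sum>s\<in>S. \<Sum>Y\<in>{Y\<in>F. Y #> s \<in> F}. f (Y #> s) * f Y) > r * real (card S) * (\<Sum>Y\<in>F. (f Y)\<^sup>2)"
proof -
  define d where "d = real (card S)"
  have d: "d > 0" using S by (simp add: d_def card_gt_0_iff)
  obtain f where l2: "(\<lambda>Y. (f Y)\<^sup>2) summable_on rcosets H" and nz: "\<exists>Y\<in>rcosets H. f Y \<noteq> 0"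
    and q: "r < inner_cosets G H (coset_walk_operator G (pmf_of_set S) f) f / inner_cosets G H f f"
    using r by (auto simp: relative_spectral_radius_def less_SUP_iff l2_cosets_def)
  have walk: "coset_walk_operator G (pmf_of_set S) f Y = (\<Sum>s\<in>S. f (Y #> s)) / d" for Y
  proof -
    have "coset_walk_operator G (pmf_of_set S) f Y = (\<Sum>\<^sub>\<infinity>s\<in>S. f (Y #> s) / d)"
      unfolding coset_walk_operator_def using S by (intro infsum_cong_neutral) (auto simp: d_def)
    then show ?thesis using S(1) by (simp add: sum_divide_distrib)
  qed
  have bij: "bij_betw (\<lambda>Y. Y #> s) (rcosets H) (rcosets H)" if "s \<in> S" for s
    using rcosets_act_bij[OF H] S(3) that by blast
  define Q where "Q = (\<Sum>\<^sub>\<infinity>Y\<in>rcosets H. (f Y)\<^sup>2)"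
  have "Q > 0"
  proof -
    obtain Y where Y: "Y \<in> rcosets H" "f Y \<noteq> 0" using nz by blast
    have "(\<Sum>y\<in>{Y}. (f y)\<^sup>2) \<le> Q"
      unfolding Q_def using Y l2 by (intro finite_sum_le_infsum) auto
    then show ?thesis using Y by (smt (verit) sum.empty sum.insert empty_iff finite.emptyI zero_less_power2)
  qed
  moreover have inner1: "inner_cosets G H f f = Q" by (simp add: inner_cosets_def Q_def power2_eq_square)
  moreover have inner2: "inner_cosets G H (coset_walk_operator G (pmf_of_set S) f) f
      = (\<Sum>s\<in>S. \<Sum>\<^sub>\<infinity>Y\<in>rcosets H. f (Y #> s) * f Y) / d"
  proof -
    have "inner_cosets G H (coset_walk_operator G (pmf_of_set S) f) f
        = (\<Sum>\<^sub>\<infinity>Y\<in>rcosets H. (\<Sum>s\<in>S. f (Y #> s) * f Y) * (1 / d))"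
      by (simp add: inner_cosets_def walk sum_distrib_right)
    also have "\<dots> = (\<Sum>\<^sub>\<infinity>Y\<in>rcosets H. (\<Sum>s\<in>S. f (Y #> s) * f Y)) * (1 / d)"
      by (rule infsum_cmult_left')
    also have "(\<Sum>\<^sub>\<infinity>Y\<in>rcosets H. (\<Sum>s\<in>S. f (Y #> s) * f Y)) = (\<Sum>s\<in>S. \<Sum>\<^sub>\<infinity>Y\<in>rcosets H. f (Y #> s) * f Y)"
      by (rule infsum_finite_sum[OF S(1)]) (rule summable_on_translate_mult[OF l2 bij])
    finally show ?thesis by simp
  qed
  ultimately have "r * d * Q < (\<Sum>s\<in>S. \<Sum>\<^sub>\<infinity>Y\<in>rcosets H. f (Y #> s) * f Y)"
    using q d unfolding inner1 inner2 by (simp add: pos_less_divide_eq mult_ac)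
  then have gt: "(\<Sum>s\<in>S. \<Sum>\<^sub>\<infinity>Y\<in>rcosets H. f (Y #> s) * f Y) > r * d * (\<Sum>\<^sub>\<infinity>Y\<in>rcosets H. (f Y)\<^sup>2)"
    by (simp only: Q_def)
  show ?thesis
  proof (rule finite_truncation_quadratic_form[OF l2 bij gt])
    fix F assume "finite F" "F \<subseteq> rcosets H"
      "(\<Sum>s\<in>S. \<Sum>Y\<in>{Y\<in>F. Y #> s \<in> F}. f (Y #> s) * f Y) > r * d * (\<Sum>Y\<in>F. (f Y)\<^sup>2)"
    then show thesis unfolding d_def by (rule that)
  qed
qed

section \<open>Traces of cosets on a subgroup\<close>

lemma l_coset_Int:
  assumes P: "subgroup P G" and h: "h \<in> P" and X: "X \<subseteq> carrier G"
  shows "(h <# X) \<inter> P = h <# (X \<inter> P)"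
proof
  show "h <# (X \<inter> P) \<subseteq> (h <# X) \<inter> P"
    using subgroup.m_closed[OF P h] by (auto simp: l_coset_def)
  show "(h <# X) \<inter> P \<subseteq> h <# (X \<inter> P)"
  proof
    fix y assume "y \<in> (h <# X) \<inter> P"
    then obtain x where x: "x \<in> X" "y = h \<otimes> x" "y \<in> P" by (auto simp: l_coset_def)
    have "x = inv h \<otimes> y"
      using x X subgroup.mem_carrier[OF P h] by (auto simp: inv_solve_left)
    then have "x \<in> P" using subgroup.m_closed[OF P subgroup.m_inv_closed[OF P h] x(3)] by simp
    then show "y \<in> h <# (X \<inter> P)" using x by (auto simp: l_coset_def)
  qed
qed

text \<open>A coset of \<open>K\<close> that meets \<open>P\<close> has a representative in
  \<open>P\<close>. This identifies P/(P \<inter> K) with the P-orbit of the base point of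
  G/K.\<close>

lemma lcosets_Int_bij:
  assumes P: "subgroup P G" and K: "subgroup K G"
  shows "bij_betw (\<lambda>X. X \<inter> P) {X \<in> lcosets K. X \<inter> P \<noteq> {}} (lcosets\<^bsub>G\<lparr>carrier := P\<rparr>\<^esub> (P \<inter> K))"
proof -
  have eq: "(h <# K) \<inter> P = h <# (P \<inter> K)" if "h \<in> P" for h
    using l_coset_Int[OF P that subgroup.subset[OF K]] by (simp add: Int_commute)
  have L: "lcosets\<^bsub>G\<lparr>carrier := P\<rparr>\<^esub> (P \<inter> K) = (\<lambda>h. h <# (P \<inter> K)) ` P"
    by (auto simp: LCOSETS_def)
  have rep: "\<exists>h\<in>P. X = h <# K" if X: "X \<in> lcosets K" "X \<inter> P \<noteq> {}" for X
  proof -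
    obtain h where "h \<in> X" "h \<in> P" using X(2) by blast
    moreover obtain a where "a \<in> carrier G" "X = a <# K" using lcosetsE[OF X(1)] .
    ultimately show ?thesis using l_repr_independence[OF _ _ K] by blast
  qed
  show ?thesis
    unfolding bij_betw_def
  proof
    show "inj_on (\<lambda>X. X \<inter> P) {X \<in> lcosets K. X \<inter> P \<noteq> {}}"
      by (rule inj_onI) (use lcos_disjoint[OF K] in blast)
    show "(\<lambda>X. X \<inter> P) ` {X \<in> lcosets K. X \<inter> P \<noteq> {}} = lcosets\<^bsub>G\<lparr>carrier := P\<rparr>\<^esub> (P \<inter> K)"
    proof
      show "(\<lambda>X. X \<inter> P) ` {X \<in> lcosets K. X \<inter> P \<noteq> {}} \<subseteq> lcosets\<^bsub>G\<lparr>carrier := P\<rparr>\<^esub> (P \<inter> K)"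
        unfolding L using rep eq by fastforce
      show "lcosets\<^bsub>G\<lparr>carrier := P\<rparr>\<^esub> (P \<inter> K) \<subseteq> (\<lambda>X. X \<inter> P) ` {X \<in> lcosets K. X \<inter> P \<noteq> {}}"
      proof
        fix Y assume "Y \<in> lcosets\<^bsub>G\<lparr>carrier := P\<rparr>\<^esub> (P \<inter> K)"
        then obtain h where h: "h \<in> P" "Y = h <# (P \<inter> K)" unfolding L by blast
        moreover have "h \<in> h <# K" using lcos_self[OF subgroup.mem_carrier[OF P h(1)] K] .
        moreover have "h <# K \<in> lcosets K" using lcoset_in_lcosets[OF subgroup.mem_carrier[OF P h(1)]] .
        ultimately show "Y \<in> (\<lambda>X. X \<inter> P) ` {X \<in> lcosets K. X \<inter> P \<noteq> {}}"
          using eq[OF h(1)] by (intro image_eqI[of _ _ "h <# K"]) auto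
      qed
    qed
  qed
qed

text \<open>Each coset of \<open>P \<inter> K\<close> in \<open>P\<close> is the trace on
  \<open>P\<close> of a coset of \<open>K\<close>, and there are only finitely many of
  these.\<close>

lemma finite_index_subgroup_Int:
  assumes P: "subgroup P G" and K: "finite_index_subgroup K G"
  shows "finite_index_subgroup (P \<inter> K) (G\<lparr>carrier := P\<rparr>)"
proof -
  have Ks: "subgroup K G" and fin: "finite (rcosets K)"
    using K by (auto simp: finite_index_subgroup_def)
  have eq: "P \<inter> K #> h = (K #> h) \<inter> P" if h: "h \<in> P" for h
  proof
    show "P \<inter> K #> h \<subseteq> (K #> h) \<inter> P"
      using subgroup.m_closed[OF P _ h] by (auto simp: r_coset_def)
    show "(K #> h) \<inter> P \<subseteq> P \<inter> K #> h"
    proof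
      fix x assume "x \<in> (K #> h) \<inter> P"
      then obtain k where k: "k \<in> K" "x = k \<otimes> h" "x \<in> P" by (auto simp: r_coset_def)
      have "k = x \<otimes> inv h"
        using k subgroup.mem_carrier[OF P h] subgroup.mem_carrier[OF Ks] by (simp add: inv_solve_right)
      then have "k \<in> P" using subgroup.m_closed[OF P k(3) subgroup.m_inv_closed[OF P h]] by simp
      then show "x \<in> P \<inter> K #> h" using k by (auto simp: r_coset_def)
    qed
  qed
  have "rcosets\<^bsub>G\<lparr>carrier := P\<rparr>\<^esub> (P \<inter> K) \<subseteq> (\<lambda>Y. Y \<inter> P) ` (rcosets K)"
  proof
    fix Y assume "Y \<in> rcosets\<^bsub>G\<lparr>carrier := P\<rparr>\<^esub> (P \<inter> K)"
    then obtain h where h: "h \<in> P" "Y = P \<inter> K #> h" by (auto simp: RCOSETS_def r_coset_def)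
    moreover have "K #> h \<in> rcosets K"
      using rcosetsI[OF subgroup.subset[OF Ks] subgroup.mem_carrier[OF P h(1)]] .
    ultimately show "Y \<in> (\<lambda>Y. Y \<inter> P) ` (rcosets K)" using eq by blast
  qed
  moreover have "subgroup (P \<inter> K) (G\<lparr>carrier := P\<rparr>)"
    using subgroup_incl[OF subgroups_Inter_pair[OF P Ks] P] by simp
  ultimately show ?thesis
    unfolding finite_index_subgroup_def using fin by (meson finite_imageI finite_subset)
qed

end

section \<open>Almost invariant functions are spread out\<close>

context group begin

text \<open>A reverse Cauchy-Schwarz inequality, with constant \<kappa>, for functions almost
  invariant under \<open>T\<close>. For the indicator of an invariant set it says that the set is
  empty or has density at least \<kappa>.\<close>

definition no_concentration :: "'a set \<Rightarrow> real \<Rightarrow> real \<Rightarrow> 'a set \<Rightarrow> bool" where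
  "no_concentration T \<epsilon> \<kappa> K \<longleftrightarrow>
    (\<forall>\<phi>. (\<forall>t\<in>T. (\<Sum>z\<in>lcosets K. (\<phi> (t <# z) - \<phi> z)\<^sup>2) \<le> \<epsilon> * (\<Sum>z\<in>lcosets K. (\<phi> z)\<^sup>2)) \<longrightarrow>
      \<kappa> * real (card (lcosets K)) * (\<Sum>z\<in>lcosets K. (\<phi> z)\<^sup>2) \<le> (\<Sum>z\<in>lcosets K. \<bar>\<phi> z\<bar>)\<^sup>2)"

text \<open>If \<open>\<phi>\<close> is almost invariant under \<open>T \<subseteq> H\<close>, then \<open>\<Theta> z\<close>, the norm over the cosets \<open>H g\<close> of
  \<open>f (H g) * \<phi> (g z)\<close>, has a Rayleigh quotient close to that of \<open>f\<close>, hence above \<open>r\<close>. This is only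
  possible if \<open>\<Theta>\<close> has a large mean, which forces a large mean of \<open>\<bar>\<phi>\<bar>\<close>.\<close>

lemma relative_spectral_radius_no_concentration:
  assumes sym: "symmetric_generating_set S G" "S \<noteq> {}" and H: "subgroup H G"
    and r: "ereal r < relative_spectral_radius G H (pmf_of_set S)"
  shows "\<exists>T \<epsilon> \<kappa>. finite T \<and> T \<subseteq> H \<and> \<epsilon> > 0 \<and> \<kappa> > 0 \<and>
    (\<forall>K. subgroup K G \<longrightarrow> finite (lcosets K) \<longrightarrow> rho_plus (schreier_graph G K S) < ereal r \<longrightarrow>
      no_concentration T \<epsilon> \<kappa> K)"
proof -
  have S: "finite S" "S \<noteq> {}" "S \<subseteq> carrier G"
    using sym by (auto simp: symmetric_generating_set_def)
  obtain f F where F: "finite F" "F \<subseteq> rcosets H"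
    and gt: "(\<Sum>s\<in>S. \<Sum>Y\<in>{Y\<in>F. Y #> s \<in> F}. f (Y #> s) * f Y) > r * real (card S) * (\<Sum>Y\<in>F. (f Y)\<^sup>2)"
    by (rule relative_spectral_radius_finite_witness[OF S H r])
  define g where "g Y = (SOME a. a \<in> carrier G \<and> Y = H #> a)" for Y
  have g: "g Y \<in> carrier G" "Y = H #> g Y" if "Y \<in> F" for Y
  proof -
    have "\<exists>a. a \<in> carrier G \<and> Y = H #> a" using that F(2) by (auto simp: RCOSETS_def)
    then have "g Y \<in> carrier G \<and> Y = H #> g Y" unfolding g_def by (rule someI_ex)
    then show "g Y \<in> carrier G" "Y = H #> g Y" by blast+
  qed
  \<comment> \<open>The cocycle of the chosen representatives: moving \<open>Y\<close> by
    \<open>s\<close> changes the representative by an element of \<open>H\<close>. These finitely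
    many elements form \<open>T\<close>.\<close>
  define h where "h s Y = g Y \<otimes> s \<otimes> inv g (Y #> s)" for s Y
  define P where "P s = {Y\<in>F. Y #> s \<in> F}" for s
  have Pfin: "finite (P s)" for s using F(1) by (simp add: P_def)
  define T where "T = (\<Union>s\<in>S. h s ` P s)"
  have sc: "s \<in> carrier G" if "s \<in> S" for s using S(3) that by blast
  have hH: "h s Y \<in> H" and hg: "g Y \<otimes> s = h s Y \<otimes> g (Y #> s)" if s: "s \<in> S" and Y: "Y \<in> P s" for s Y
  proof -
    have Y: "Y \<in> F" "Y #> s \<in> F" using Y by (auto simp: P_def)
    have "Y #> s = H #> (g Y \<otimes> s)"
      using g(2)[OF Y(1)] coset_mult_assoc[OF subgroup.subset[OF H] g(1)[OF Y(1)] sc[OF s]] by simp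
    then have "g Y \<otimes> s \<in> H #> g (Y #> s)"
      using g(2)[OF Y(2)] rcos_self[OF m_closed[OF g(1)[OF Y(1)] sc[OF s]] H] by simp
    then show "h s Y \<in> H"
      unfolding h_def
      using subgroup.rcos_module_imp[OF H is_group g(1)[OF Y(2)]] by blast
    show "g Y \<otimes> s = h s Y \<otimes> g (Y #> s)"
      using g(1)[OF Y(1)] g(1)[OF Y(2)] sc[OF s] by (simp add: h_def m_assoc)
  qed
  have TH: "T \<subseteq> H" using hH by (auto simp: T_def)
  have hc: "h s Y \<in> carrier G" if "s \<in> S" "Y \<in> P s" for s Y
    using hH[OF that] subgroup.mem_carrier[OF H] by blast
  define d where "d = real (card S)"
  have d: "d > 0" using S(1,2) by (simp add: d_def card_gt_0_iff)
  define c where "c = (\<Sum>Y\<in>F. (f Y)\<^sup>2)"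
  define l where "l = (\<Sum>Y\<in>F. \<bar>f Y\<bar>)"
  define a where "a = (\<Sum>s\<in>S. \<Sum>Y\<in>P s. f (Y #> s) * f Y)"
  define b where "b = (\<Sum>s\<in>S. \<Sum>Y\<in>P s. \<bar>f (Y #> s) * f Y\<bar>)"
  \<comment> \<open>The excess of the form of \<open>f\<close> over \<open>r\<close>, to be split in
    two: \<epsilon> makes the loss from imperfect invariance at most \<open>\<gamma>/2\<close>, and
    the other half must be paid for by the mean, which fixes \<kappa>. The added ones keep the
    denominators positive.\<close>
  define \<gamma> where "\<gamma> = a - r * d * c"
  have \<gamma>: "\<gamma> > 0" using gt by (simp add: \<gamma>_def a_def d_def c_def P_def)
  have b: "b \<ge> 0" unfolding b_def by (intro sum_nonneg) simp
  define \<epsilon> where "\<epsilon> = \<gamma> / (b + 1)"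
  define E where "E = d * (1 + \<bar>r\<bar>) * (l\<^sup>2 + 1)"
  have "1 + \<bar>r\<bar> > 0" "l\<^sup>2 + 1 > 0" using zero_le_power2[of l] by linarith+
  then have E: "E > 0" using d by (simp add: E_def)
  define \<kappa> where "\<kappa> = \<gamma> / (2 * E)"
  have eb: "b * (\<epsilon> / 2) \<le> \<gamma> / 2" using b \<gamma> by (simp add: \<epsilon>_def field_simps)
  have main: "no_concentration T \<epsilon> \<kappa> K"
    if K: "subgroup K G" and fin: "finite (lcosets K)" and rho: "rho_plus (schreier_graph G K S) < ereal r" for K
    unfolding no_concentration_def
  proof (intro allI impI)
    fix \<phi> :: "'a set \<Rightarrow> real"
    assume inv: "\<forall>t\<in>T. (\<Sum>z\<in>lcosets K. (\<phi> (t <# z) - \<phi> z)\<^sup>2) \<le> \<epsilon> * (\<Sum>z\<in>lcosets K. (\<phi> z)\<^sup>2)"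
    define Z where "Z = lcosets K"
    define N where "N = real (card Z)"
    have N: "N > 0"
      using fin lcoset_in_lcosets[OF one_closed, of K] by (auto simp: N_def Z_def card_gt_0_iff)
    define p where "p = (\<Sum>z\<in>Z. (\<phi> z)\<^sup>2)"
    define q where "q = (\<Sum>z\<in>Z. \<bar>\<phi> z\<bar>)"
    have tr: "(\<Sum>z\<in>Z. v (x <# z)) = (\<Sum>z\<in>Z. v z)" if "x \<in> carrier G" for x and v :: "'a set \<Rightarrow> real"
      unfolding Z_def using sum.reindex_bij_betw[OF lcosets_act_bij[OF K that]] .
    define \<Theta> where "\<Theta> z = L2_set (\<lambda>Y. f Y * \<phi> (g Y <# z)) F" for z
    have "(\<Sum>z\<in>Z. (\<Theta> z)\<^sup>2) = (\<Sum>z\<in>Z. \<Sum>Y\<in>F. (f Y)\<^sup>2 * (\<phi> (g Y <# z))\<^sup>2)"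
      by (simp add: \<Theta>_def L2_set_def sum_nonneg power_mult_distrib)
    also have "\<dots> = (\<Sum>Y\<in>F. (f Y)\<^sup>2 * (\<Sum>z\<in>Z. (\<phi> (g Y <# z))\<^sup>2))"
      by (subst sum.swap) (simp add: sum_distrib_left)
    also have "\<dots> = (\<Sum>Y\<in>F. (f Y)\<^sup>2 * p)"
      by (intro sum.cong refl) (simp add: tr[OF g(1), of _ "\<lambda>z. (\<phi> z)\<^sup>2"] p_def)
    also have "\<dots> = c * p" by (simp add: c_def sum_distrib_right)
    finally have \<Theta>2: "(\<Sum>z\<in>Z. (\<Theta> z)\<^sup>2) = c * p" .
    have \<Theta>0: "\<Theta> z \<ge> 0" for z by (simp add: \<Theta>_def)
    have "(\<Sum>z\<in>Z. \<Theta> z) \<le> (\<Sum>z\<in>Z. \<Sum>Y\<in>F. \<bar>f Y\<bar> * \<bar>\<phi> (g Y <# z)\<bar>)"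
      unfolding \<Theta>_def by (intro sum_mono order_trans[OF L2_set_le_sum_abs]) (simp add: abs_mult)
    also have "\<dots> = (\<Sum>Y\<in>F. \<bar>f Y\<bar> * (\<Sum>z\<in>Z. \<bar>\<phi> (g Y <# z)\<bar>))"
      by (subst sum.swap) (simp add: sum_distrib_left)
    also have "\<dots> = (\<Sum>Y\<in>F. \<bar>f Y\<bar> * q)"
      by (intro sum.cong refl) (simp add: tr[OF g(1), of _ "\<lambda>z. \<bar>\<phi> z\<bar>"] q_def)
    also have "\<dots> = l * q" by (simp add: l_def sum_distrib_right)
    finally have \<Theta>1: "(\<Sum>z\<in>Z. \<Theta> z) \<le> l * q" .
    have lower: "(\<Sum>z\<in>Z. \<Theta> (s <# z) * \<Theta> z) \<ge>
        (\<Sum>Y\<in>P s. f (Y #> s) * f Y) * p - (\<Sum>Y\<in>P s. \<bar>f (Y #> s) * f Y\<bar>) * (\<epsilon>/2 * p)"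
      if s: "s \<in> S" for s
    proof -
      \<comment> \<open>Cauchy-Schwarz over the cosets: the term of \<open>\<Theta> (s <# z)\<close>
        at \<open>Y\<close> is paired with the term of \<open>\<Theta> z\<close> at
        \<open>Y #> s\<close>, and distinct \<open>Y\<close> have distinct partners.\<close>
      have pointwise: "(\<Sum>Y\<in>P s. (f Y * \<phi> (g Y <# (s <# z))) * (f (Y #> s) * \<phi> (g (Y #> s) <# z))) \<le> \<Theta> (s <# z) * \<Theta> z"
        for z
      proof -
        let ?u = "\<lambda>Y. f Y * \<phi> (g Y <# (s <# z))" and ?v = "\<lambda>Y. f Y * \<phi> (g Y <# z)"
        have "(\<Sum>Y\<in>P s. ?u Y * ?v (Y #> s)) \<le> (\<Sum>Y\<in>P s. \<bar>?u Y\<bar> * \<bar>?v (Y #> s)\<bar>)"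
          by (intro sum_mono) (metis abs_ge_self abs_mult)
        also have "\<dots> \<le> L2_set ?u (P s) * L2_set (\<lambda>Y. ?v (Y #> s)) (P s)"
          by (rule L2_set_mult_ineq)
        also have "\<dots> \<le> L2_set ?u F * L2_set ?v F"
        proof (intro mult_mono L2_set_nonneg)
          show "L2_set ?u (P s) \<le> L2_set ?u F"
            unfolding L2_set_def using F(1) by (intro real_sqrt_le_mono sum_mono2) (auto simp: P_def)
          have "inj_on (\<lambda>Y. Y #> s) (P s)"
          proof (rule inj_onI)
            fix Y Y' assume YY: "Y \<in> P s" "Y' \<in> P s" "Y #> s = Y' #> s"
            then have sub: "Y \<subseteq> carrier G" "Y' \<subseteq> carrier G"
              using F(2) subgroup.rcosets_carrier[OF H is_group] by (auto simp: P_def subset_iff)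
            have "Y #> s #> inv s = Y' #> s #> inv s" using YY(3) by simp
            then show "Y = Y'" using sub sc[OF s] by (simp add: coset_mult_assoc)
          qed
          then have "(\<Sum>Y\<in>P s. (?v (Y #> s))\<^sup>2) = (\<Sum>Y\<in>(\<lambda>Y. Y #> s) ` P s. (?v Y)\<^sup>2)"
            by (simp add: sum.reindex)
          also have "\<dots> \<le> (\<Sum>Y\<in>F. (?v Y)\<^sup>2)"
            using F(1) by (intro sum_mono2) (auto simp: P_def)
          finally show "L2_set (\<lambda>Y. ?v (Y #> s)) (P s) \<le> L2_set ?v F"
            unfolding L2_set_def by (rule real_sqrt_le_mono)
        qed
        finally show ?thesis by (simp add: \<Theta>_def)
      qed
      \<comment> \<open>The cocycle relation and the substitution of \<open>g (Y #> s) <# z\<close>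
        by \<open>z\<close> turn this sum into the correlation of \<open>\<phi>\<close> with its
        translate by \<open>h s Y\<close>, which is \<open>p\<close> minus half the squared
        displacement.\<close>
      have corr: "\<bar>(\<Sum>z\<in>Z. \<phi> (g Y <# (s <# z)) * \<phi> (g (Y #> s) <# z)) - p\<bar> \<le> \<epsilon>/2 * p" if Y: "Y \<in> P s" for Y
      proof -
        have gY: "g Y \<in> carrier G" "g (Y #> s) \<in> carrier G" using Y g by (auto simp: P_def)
        have "g Y <# (s <# z) = h s Y <# (g (Y #> s) <# z)" if "z \<in> Z" for z
          using that lcosets_act_mult[OF K, of z] gY sc[OF s] hg[OF s Y] hc[OF s Y] unfolding Z_def by metis
        then have "(\<Sum>z\<in>Z. \<phi> (g Y <# (s <# z)) * \<phi> (g (Y #> s) <# z))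
            = (\<Sum>z\<in>Z. \<phi> (h s Y <# (g (Y #> s) <# z)) * \<phi> (g (Y #> s) <# z))"
          by simp
        also have "\<dots> = (\<Sum>z\<in>Z. \<phi> (h s Y <# z) * \<phi> z)"
          by (rule tr[OF gY(2), of "\<lambda>z. \<phi> (h s Y <# z) * \<phi> z"])
        finally have 1: "(\<Sum>z\<in>Z. \<phi> (g Y <# (s <# z)) * \<phi> (g (Y #> s) <# z)) = (\<Sum>z\<in>Z. \<phi> (h s Y <# z) * \<phi> z)" .
        have "(\<Sum>z\<in>Z. (\<phi> (h s Y <# z) - \<phi> z)\<^sup>2) = 2 * p - 2 * (\<Sum>z\<in>Z. \<phi> (h s Y <# z) * \<phi> z)"
          using tr[OF hc[OF s Y], of "\<lambda>z. (\<phi> z)\<^sup>2"]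
          by (simp add: p_def power2_diff sum_subtractf sum.distrib sum_distrib_left mult.assoc)
        moreover have "(\<Sum>z\<in>Z. (\<phi> (h s Y <# z) - \<phi> z)\<^sup>2) \<le> \<epsilon> * p"
          unfolding p_def Z_def using s Y by (intro inv[rule_format]) (auto simp: T_def)
        moreover have "(\<Sum>z\<in>Z. (\<phi> (h s Y <# z) - \<phi> z)\<^sup>2) \<ge> 0" by (intro sum_nonneg) simp
        ultimately show ?thesis unfolding 1 by (simp add: abs_le_iff)
      qed
      have "(\<Sum>Y\<in>P s. f (Y #> s) * f Y) * p - (\<Sum>Y\<in>P s. \<bar>f (Y #> s) * f Y\<bar>) * (\<epsilon>/2 * p)
          = (\<Sum>Y\<in>P s. f (Y #> s) * f Y * p - \<bar>f (Y #> s) * f Y\<bar> * (\<epsilon>/2 * p))"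
        by (simp only: sum_subtractf sum_distrib_right)
      also have "\<dots> \<le> (\<Sum>Y\<in>P s. f (Y #> s) * f Y * (\<Sum>z\<in>Z. \<phi> (g Y <# (s <# z)) * \<phi> (g (Y #> s) <# z)))"
      proof (rule sum_mono)
        fix Y assume Y: "Y \<in> P s"
        let ?w = "f (Y #> s) * f Y" and ?e = "(\<Sum>z\<in>Z. \<phi> (g Y <# (s <# z)) * \<phi> (g (Y #> s) <# z)) - p"
        have "\<bar>?w * ?e\<bar> \<le> \<bar>?w\<bar> * (\<epsilon>/2 * p)"
          unfolding abs_mult[of ?w ?e] by (rule mult_left_mono[OF corr[OF Y]]) simp
        then have "?w * p - \<bar>?w\<bar> * (\<epsilon>/2 * p) \<le> ?w * p + ?w * ?e" by linarith
        then show "?w * p - \<bar>?w\<bar> * (\<epsilon>/2 * p) \<le> ?w * (\<Sum>z\<in>Z. \<phi> (g Y <# (s <# z)) * \<phi> (g (Y #> s) <# z))"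
          by (simp add: algebra_simps)
      qed
      also have "\<dots> = (\<Sum>z\<in>Z. \<Sum>Y\<in>P s. (f Y * \<phi> (g Y <# (s <# z))) * (f (Y #> s) * \<phi> (g (Y #> s) <# z)))"
        unfolding sum_distrib_left by (subst sum.swap) (simp add: mult_ac)
      also have "\<dots> \<le> (\<Sum>z\<in>Z. \<Theta> (s <# z) * \<Theta> z)" by (intro sum_mono pointwise)
      finally show ?thesis .
    qed
    have "a * p - b * (\<epsilon>/2 * p) = (\<Sum>s\<in>S. (\<Sum>Y\<in>P s. f (Y #> s) * f Y) * p - (\<Sum>Y\<in>P s. \<bar>f (Y #> s) * f Y\<bar>) * (\<epsilon>/2 * p))"
      by (simp only: a_def b_def sum_subtractf sum_distrib_right)
    also have "\<dots> \<le> (\<Sum>s\<in>S. \<Sum>z\<in>Z. \<Theta> (s <# z) * \<Theta> z)" by (intro sum_mono lower)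
    finally have low: "a * p - b * (\<epsilon>/2 * p) \<le> (\<Sum>s\<in>S. \<Sum>z\<in>Z. \<Theta> (s <# z) * \<Theta> z)" .
    \<comment> \<open>The spectral bound applies only after subtracting the mean. This removes
      \<open>N * m\<^sup>2\<close> from the norm and from each of the \<open>d\<close> correlations,
      so the bound for \<open>\<Theta>\<close> itself carries the correction
      \<open>d * (1 - r) * (N * m\<^sup>2)\<close>.\<close>
    define m where "m = (\<Sum>z\<in>Z. \<Theta> z) / N"
    have mN: "(\<Sum>z\<in>Z. \<Theta> z) = m * N" using N by (simp add: m_def)
    have NZ: "(\<Sum>z\<in>Z. x) = N * x" for x :: real by (simp add: N_def)
    have "(\<Sum>z\<in>Z. \<Theta> z - m) = 0" by (simp add: sum_subtractf mN NZ del: sum_constant)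
    then have "(\<Sum>s\<in>S. \<Sum>z\<in>Z. (\<Theta> (s <# z) - m) * (\<Theta> z - m)) \<le> r * d * (\<Sum>z\<in>Z. (\<Theta> z - m)\<^sup>2)"
      using schreier_quadratic_form_le[OF sym K fin rho, of "\<lambda>z. \<Theta> z - m"] by (simp add: Z_def d_def)
    also have "(\<Sum>z\<in>Z. (\<Theta> z - m)\<^sup>2) = c * p - N * m\<^sup>2"
    proof -
      have "(\<Sum>z\<in>Z. (\<Theta> z - m)\<^sup>2) = (\<Sum>z\<in>Z. (\<Theta> z)\<^sup>2) + N * m\<^sup>2 - 2 * m * (\<Sum>z\<in>Z. \<Theta> z)"
        by (simp add: power2_diff sum_subtractf sum.distrib NZ sum_distrib_left sum_distrib_right mult_ac del: sum_constant)
      then show ?thesis unfolding \<Theta>2 mN by (simp add: power2_eq_square algebra_simps)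
    qed
    also have "(\<Sum>s\<in>S. \<Sum>z\<in>Z. (\<Theta> (s <# z) - m) * (\<Theta> z - m)) = (\<Sum>s\<in>S. (\<Sum>z\<in>Z. \<Theta> (s <# z) * \<Theta> z) - N * m\<^sup>2)"
    proof (intro sum.cong refl)
      fix s assume s: "s \<in> S"
      have "(\<Sum>z\<in>Z. (\<Theta> (s <# z) - m) * (\<Theta> z - m))
          = (\<Sum>z\<in>Z. \<Theta> (s <# z) * \<Theta> z) - m * (\<Sum>z\<in>Z. \<Theta> (s <# z)) - m * (\<Sum>z\<in>Z. \<Theta> z) + N * (m * m)"
        by (simp add: algebra_simps sum_subtractf sum.distrib NZ sum_distrib_left del: sum_constant)
      then show "(\<Sum>z\<in>Z. (\<Theta> (s <# z) - m) * (\<Theta> z - m)) = (\<Sum>z\<in>Z. \<Theta> (s <# z) * \<Theta> z) - N * m\<^sup>2"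
        unfolding tr[OF sc[OF s], of \<Theta>] mN by (simp add: power2_eq_square)
    qed
    also have "\<dots> = (\<Sum>s\<in>S. \<Sum>z\<in>Z. \<Theta> (s <# z) * \<Theta> z) - d * (N * m\<^sup>2)"
      by (simp add: sum_subtractf d_def)
    finally have up: "(\<Sum>s\<in>S. \<Sum>z\<in>Z. \<Theta> (s <# z) * \<Theta> z) \<le> r * d * (c * p - N * m\<^sup>2) + d * (N * m\<^sup>2)"
      by simp
    have p0: "p \<ge> 0" unfolding p_def by (intro sum_nonneg) simp
    have "\<gamma> * p = a * p - r * d * c * p" by (simp add: \<gamma>_def algebra_simps)
    also have "\<dots> \<le> b * (\<epsilon>/2) * p + d * (1 - r) * (N * m\<^sup>2)"
      using low up by (simp add: algebra_simps)
    also have "\<dots> \<le> \<gamma>/2 * p + d * (1 + \<bar>r\<bar>) * (N * m\<^sup>2)"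
      using eb p0 d N by (intro add_mono mult_right_mono mult_left_mono) auto
    \<comment> \<open>The remaining half of the excess is bounded by the mean of
      \<open>\<Theta>\<close>; since that mean is controlled by the L1 norm \<open>q\<close> of
      \<open>\<phi>\<close>, the claim follows.\<close>
    finally have "\<gamma>/2 * p \<le> d * (1 + \<bar>r\<bar>) * (N * m\<^sup>2)" by simp
    then have "N * (\<gamma>/2 * p) \<le> N * (d * (1 + \<bar>r\<bar>) * (N * m\<^sup>2))" using N by (intro mult_left_mono) auto
    also have "\<dots> = d * (1 + \<bar>r\<bar>) * (m * N)\<^sup>2" by (simp add: power2_eq_square)
    also have "\<dots> \<le> d * (1 + \<bar>r\<bar>) * (l * q)\<^sup>2"
      using \<Theta>1 \<Theta>0 d unfolding mN[symmetric] by (intro mult_left_mono power_mono sum_nonneg) auto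
    also have "\<dots> = d * (1 + \<bar>r\<bar>) * l\<^sup>2 * q\<^sup>2" by (simp add: power_mult_distrib)
    also have "\<dots> \<le> E * q\<^sup>2"
      unfolding E_def using d by (intro mult_right_mono mult_left_mono) auto
    finally have "N * (\<gamma>/2 * p) / E \<le> q\<^sup>2" using E by (simp add: pos_divide_le_eq mult.commute)
    moreover have "\<kappa> * N * p = N * (\<gamma>/2 * p) / E" by (simp add: \<kappa>_def)
    ultimately show "\<kappa> * real (card (lcosets K)) * (\<Sum>z\<in>lcosets K. (\<phi> z)\<^sup>2) \<le> (\<Sum>z\<in>lcosets K. \<bar>\<phi> z\<bar>)\<^sup>2"
      by (simp add: N_def Z_def p_def q_def)
  qed
  have "finite T" using S(1) Pfin by (simp add: T_def)
  moreover have "\<epsilon> > 0" using \<gamma> b by (simp add: \<epsilon>_def)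
  moreover have "\<kappa> > 0" using \<gamma> E by (simp add: \<kappa>_def)
  ultimately show ?thesis using TH main by blast
qed

end

subsection \<open>Restriction to a subgroup\<close>

context group begin

text \<open>Moves functions from P/(P \<inter> K) to G/K by extending them by zero off the P-orbit
  of the base point.\<close>

lemma sum_lcosets_Int:
  assumes P: "subgroup P G" and K: "subgroup K G" and fin: "finite (lcosets K)"
  shows "(\<Sum>X\<in>lcosets K. if X \<inter> P = {} then 0 else v (X \<inter> P)) =
    (\<Sum>Y\<in>lcosets\<^bsub>G\<lparr>carrier := P\<rparr>\<^esub> (P \<inter> K). v Y :: real)"
proof -
  have "(\<Sum>X\<in>lcosets K. if X \<inter> P = {} then 0 else v (X \<inter> P))
      = (\<Sum>X\<in>{X \<in> lcosets K. X \<inter> P \<noteq> {}}. v (X \<inter> P))"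
    using fin by (intro sum.mono_neutral_cong_right) auto
  also have "\<dots> = (\<Sum>Y\<in>lcosets\<^bsub>G\<lparr>carrier := P\<rparr>\<^esub> (P \<inter> K). v Y)"
    by (rule sum.reindex_bij_betw[OF lcosets_Int_bij[OF P K]])
  finally show ?thesis .
qed

text \<open>Since \<open>K\<close> is normal, each right coset of \<open>P <#> K\<close> contains a
  coset of \<open>K\<close>, and the cosets of \<open>K\<close> inside it form a P-invariant set.
  These sets are disjoint and each has density at least \<kappa>, so there are at most
  \<open>1 / \<kappa>\<close> of them.\<close>

lemma card_rcosets_mult_le:
  assumes P: "subgroup P G" and K: "K \<lhd> G" and fin: "finite (lcosets K)" and \<kappa>: "\<kappa> > 0"
    and large: "\<And>A. \<lbrakk>A \<subseteq> lcosets K; A \<noteq> {}; \<And>t X. t \<in> P \<Longrightarrow> X \<in> lcosets K \<Longrightarrow> t <# X \<in> A \<longleftrightarrow> X \<in> A\<rbrakk>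
      \<Longrightarrow> \<kappa> * real (card (lcosets K)) \<le> real (card A)"
  shows "finite (rcosets (P <#> K)) \<and> \<kappa> * real (card (rcosets (P <#> K))) \<le> 1"
proof -
  define B where "B = P <#> K"
  have Ks: "subgroup K G" using K by (simp add: normal_imp_subgroup)
  have B: "subgroup B G"
    unfolding B_def commut_normal[OF P K] by (rule mult_norm_subgroup[OF K P])
  define A where "A Z = {X \<in> lcosets K. X \<subseteq> Z}" for Z
  have PB: "P \<subseteq> B"
    unfolding B_def set_mult_def using subgroup.one_closed[OF Ks] subgroup.mem_carrier[OF P] by force
  have KB: "K \<subseteq> B"
    unfolding B_def set_mult_def using subgroup.one_closed[OF P] subgroup.mem_carrier[OF Ks] by force
  have closed: "t <# X \<subseteq> Z" if t: "t \<in> P" and X: "X \<subseteq> Z" and Z: "Z \<in> rcosets B" for t X Z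
  proof -
    obtain a where a: "a \<in> carrier G" "Z = B #> a" using Z by (auto simp: RCOSETS_def)
    have "t \<otimes> (b \<otimes> a) \<in> Z" if b: "b \<in> B" for b
    proof -
      have "t \<otimes> (b \<otimes> a) = t \<otimes> b \<otimes> a"
        using t PB a(1) b subgroup.mem_carrier[OF B] by (simp add: m_assoc subset_iff)
      then show ?thesis
        using subgroup.m_closed[OF B _ b] t PB a(2) by (auto simp: r_coset_def)
    qed
    then show ?thesis using X a(2) by (auto simp: l_coset_def r_coset_def)
  qed
  have A_large: "\<kappa> * real (card (lcosets K)) \<le> real (card (A Z))" and A_ne: "A Z \<noteq> {}"
    if Z: "Z \<in> rcosets B" for Z
  proof -
    obtain a where a: "a \<in> carrier G" "Z = B #> a" using Z by (auto simp: RCOSETS_def)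
    have "a <# K = K #> a" using normal.coset_eq[OF K] a(1) by simp
    also have "\<dots> \<subseteq> Z" using KB a(2) by (auto simp: r_coset_def)
    finally show ne: "A Z \<noteq> {}" using lcoset_in_lcosets[OF a(1)] by (auto simp: A_def)
    show "\<kappa> * real (card (lcosets K)) \<le> real (card (A Z))"
    proof (rule large)
      fix t X assume t: "t \<in> P" and X: "X \<in> lcosets K"
      have tG: "t \<in> carrier G" using subgroup.mem_carrier[OF P t] .
      have "inv t <# (t <# X) \<subseteq> Z" if "t <# X \<subseteq> Z"
        using closed[OF subgroup.m_inv_closed[OF P t] that Z] .
      then have "t <# X \<subseteq> Z \<longleftrightarrow> X \<subseteq> Z"
        using closed[OF t _ Z] lcosets_act_inv(1)[OF Ks X tG] by auto
      then show "t <# X \<in> A Z \<longleftrightarrow> X \<in> A Z"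
        using X lcosets_act_closed[OF Ks X tG] by (simp add: A_def)
    qed (use ne in \<open>auto simp: A_def\<close>)
  qed
  have disj: "A Z \<inter> A Z' = {}" if Z: "Z \<in> rcosets B" "Z' \<in> rcosets B" "Z \<noteq> Z'" for Z Z'
  proof -
    have "Z \<inter> Z' = {}" using rcos_disjoint[OF B] Z by (auto simp: pairwise_def disjnt_def)
    moreover have "X \<noteq> {}" if "X \<in> lcosets K" for X
      using that lcos_self[OF _ Ks] by (auto elim!: lcosetsE)
    ultimately show ?thesis by (fastforce simp: A_def)
  qed
  have finA: "finite (A Z)" for Z using fin by (simp add: A_def)
  \<comment> \<open>Nonempty disjoint values make \<open>A\<close> injective. Finiteness has to come
    before the count, since \<open>card\<close> of an infinite set is 0.\<close>
  have "inj_on A (rcosets B)"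
    by (rule inj_onI) (metis A_ne disj inf.idem)
  moreover have "A ` (rcosets B) \<subseteq> Pow (lcosets K)" by (auto simp: A_def)
  ultimately have finB: "finite (rcosets B)"
    using fin by (meson finite_Pow_iff finite_imageD finite_subset)
  have "real (card (rcosets B)) * (\<kappa> * real (card (lcosets K))) \<le> (\<Sum>Z\<in>rcosets B. real (card (A Z)))"
    using A_large by (rule sum_bounded_below)
  also have "\<dots> = real (card (\<Union>Z\<in>rcosets B. A Z))"
    using finB finA disj by (subst card_UN_disjoint) auto
  also have "\<dots> \<le> real (card (lcosets K))"
    using fin by (intro of_nat_mono card_mono) (auto simp: A_def)
  finally have "(\<kappa> * real (card (rcosets B))) * real (card (lcosets K)) \<le> 1 * real (card (lcosets K))"
    by (simp add: mult_ac)
  moreover have "real (card (lcosets K)) > 0"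
    using fin lcoset_in_lcosets[OF one_closed, of K] by (auto simp: card_gt_0_iff)
  ultimately have "\<kappa> * real (card (rcosets B)) \<le> 1" by (simp only: mult_le_cancel_right_pos)
  then show ?thesis using finB by (simp add: B_def)
qed

end

text \<open>Every coset graph has a single vertex, hence no nonzero function of zero sum, and
  \<open>rho_plus\<close> is minus infinity; the empty set serves as the symmetric generating
  set.\<close>

lemma trivial_group_property_tau:
  assumes G: "group G" and triv: "carrier G = {\<one>\<^bsub>G\<^esub>}"
    and K: "\<forall>n. finite_index_subgroup (K n) G"
  shows "finitely_generated_subgroup {\<one>\<^bsub>G\<^esub>} G"
    and "property_tau (G\<lparr>carrier := {\<one>\<^bsub>G\<^esub>}\<rparr>) (\<lambda>n. {\<one>\<^bsub>G\<^esub>} \<inter> K n)"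
    and "card (rcosets\<^bsub>G\<^esub> B) = 1"
proof -
  interpret group G by fact
  define D where "D = G\<lparr>carrier := {\<one>\<^bsub>G\<^esub>}\<rparr>"
  show "finitely_generated_subgroup {\<one>\<^bsub>G\<^esub>} G"
    unfolding finitely_generated_subgroup_def using triv_subgroup generate_one by blast
  show "card (rcosets\<^bsub>G\<^esub> B) = 1" by (simp add: RCOSETS_def triv)
  have single: "lcosets\<^bsub>D\<^esub> L = {\<one>\<^bsub>G\<^esub> <#\<^bsub>G\<^esub> L}" for L by (simp add: D_def LCOSETS_def)
  have "rho_plus (schreier_graph D L {}) = -\<infinity>" for L
  proof -
    have "\<not> nontrivial_eigenvalue (schreier_graph D L {}) \<mu>" for \<mu>
      unfolding nontrivial_eigenvalue_def schreier_graph_def single by simp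
    then show ?thesis by (simp add: rho_plus_def bot_ereal_def)
  qed
  moreover have "symmetric_generating_set {} D"
    unfolding symmetric_generating_set_def D_def
    using generate_consistent[of "{}" "{\<one>\<^bsub>G\<^esub>}"] triv_subgroup generate_empty by (simp add: SET_INV_def)
  moreover have "finite_index_subgroup ({\<one>\<^bsub>G\<^esub>} \<inter> K n) D" for n
    unfolding D_def using finite_index_subgroup_Int[OF triv_subgroup] K by blast
  ultimately have "property_tau D (\<lambda>n. {\<one>\<^bsub>G\<^esub>} \<inter> K n)"
    unfolding property_tau_def by (auto intro!: exI[of _ "{}"])
  then show "property_tau (G\<lparr>carrier := {\<one>\<^bsub>G\<^esub>}\<rparr>) (\<lambda>n. {\<one>\<^bsub>G\<^esub>} \<inter> K n)"
    by (simp add: D_def)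
qed

section \<open>From non-concentration to property (\<tau>) and bounded index\<close>

theorem theorem4:
  fixes G :: "('a, 'b) monoid_scheme"
    and S H :: "'a set"
    and K :: "nat \<Rightarrow> 'a set"
  assumes "group G"
    and "symmetric_generating_set S G"
    and "\<forall>n. finite_index_subgroup (K n) G"
    and "decseq K"
    and "subgroup H G"
    and "relative_spectral_radius G H (pmf_of_set S) > (SUP n. rho_plus (schreier_graph G (K n) S))"
  shows "\<exists>H'. finitely_generated_subgroup H' G \<and> H' \<subseteq> H \<and>
           property_tau (G\<lparr>carrier := H'\<rparr>) (\<lambda>n. H' \<inter> K n) \<and>
           ((\<forall>n. K n \<lhd> G) \<longrightarrow>
             (\<exists>M::nat. M > 0 \<and> (\<forall>n. finite (rcosets\<^bsub>G\<^esub> (H' <#>\<^bsub>G\<^esub> K n)) \<and>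
                                   card (rcosets\<^bsub>G\<^esub> (H' <#>\<^bsub>G\<^esub> K n)) < M)))"
proof (cases "S = {}")
  case True
  \<comment> \<open>\<open>pmf_of_set {}\<close> is unspecified, so the spectral hypothesis says nothing here; but \<open>G\<close> is trivial.\<close>
  interpret group G by fact
  have triv: "carrier G = {\<one>\<^bsub>G\<^esub>}"
    using assms(2) True generate_empty by (simp add: symmetric_generating_set_def)
  have fin: "finite (rcosets\<^bsub>G\<^esub> B)" "card (rcosets\<^bsub>G\<^esub> B) < 2" for B
    using trivial_group_property_tau(3)[OF assms(1) triv assms(3), of B] card.infinite by fastforce+
  have "{\<one>\<^bsub>G\<^esub>} \<subseteq> H" using subgroup.one_closed[OF assms(5)] by simp
  then show ?thesis
    using trivial_group_property_tau(1,2)[OF assms(1) triv assms(3)] fin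
    by (intro exI[of _ "{\<one>\<^bsub>G\<^esub>}"] conjI impI exI[of _ 2]) auto
next
  case False
  interpret group G by fact
  have S: "finite S" "S \<subseteq> carrier G" using assms(2) by (auto simp: symmetric_generating_set_def)
  have K: "subgroup (K n) G" and Kr: "finite (rcosets\<^bsub>G\<^esub> (K n))" for n
    using assms(3) by (auto simp: finite_index_subgroup_def)
  have Kl: "finite (lcosets\<^bsub>G\<^esub> (K n))" for n using finite_lcosets[OF K Kr] .
  obtain r where r: "(SUP n. rho_plus (schreier_graph G (K n) S)) < ereal r"
    "ereal r < relative_spectral_radius G H (pmf_of_set S)"
    using ereal_dense2[OF assms(6)] by blast
  have rn: "rho_plus (schreier_graph G (K n) S) < ereal r" for n
    using r(1) by (meson SUP_upper UNIV_I le_less_trans)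
  obtain T0 \<epsilon> \<kappa> where T0: "finite T0" "T0 \<subseteq> H" and \<epsilon>: "\<epsilon> > 0" and \<kappa>: "\<kappa> > 0"
    and conc: "\<forall>K. subgroup K G \<longrightarrow> finite (lcosets\<^bsub>G\<^esub> K) \<longrightarrow>
      rho_plus (schreier_graph G K S) < ereal r \<longrightarrow> no_concentration T0 \<epsilon> \<kappa> K"
    using relative_spectral_radius_no_concentration[OF assms(2) False assms(5) r(2)] by blast
  have mean: "\<kappa> * real (card (lcosets\<^bsub>G\<^esub> (K n))) * (\<Sum>z\<in>lcosets\<^bsub>G\<^esub> (K n). (\<phi> z)\<^sup>2)
      \<le> (\<Sum>z\<in>lcosets\<^bsub>G\<^esub> (K n). \<bar>\<phi> z\<bar>)\<^sup>2"
    if "\<And>t. t \<in> T0 \<Longrightarrow> (\<Sum>z\<in>lcosets\<^bsub>G\<^esub> (K n). (\<phi> (t <#\<^bsub>G\<^esub> z) - \<phi> z)\<^sup>2) \<le> \<epsilon> * (\<Sum>z\<in>lcosets\<^bsub>G\<^esub> (K n). (\<phi> z)\<^sup>2)"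
    for n \<phi>
    using conc[rule_format, OF K Kl rn] that unfolding no_concentration_def by simp
  \<comment> \<open>Inverses make the set symmetric, and the identity makes it nonempty even when
    \<open>T0\<close> is empty, as the eigenvalue argument requires.\<close>
  define T where "T = insert \<one>\<^bsub>G\<^esub> (T0 \<union> (\<lambda>t. inv\<^bsub>G\<^esub> t) ` T0)"
  have TH: "T \<subseteq> H"
    using T0(2) subgroup.one_closed[OF assms(5)] subgroup.m_inv_closed[OF assms(5)] by (auto simp: T_def)
  have TG: "T \<subseteq> carrier G" using TH subgroup.subset[OF assms(5)] by blast
  define P where "P = generate G T"
  have P: "subgroup P G" unfolding P_def by (rule generate_is_subgroup[OF TG])
  have PH: "P \<subseteq> H" unfolding P_def by (rule generate_subgroup_incl[OF TH assms(5)])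
  have TP: "T \<subseteq> P" unfolding P_def by (auto intro: generate.incl)
  have finT: "finite T" using T0(1) by (simp add: T_def)
  define D where "D = G\<lparr>carrier := P\<rparr>"
  have D: "group D" unfolding D_def by (rule subgroup.subgroup_is_group[OF P is_group])
  have index: "finite_index_subgroup (P \<inter> K n) D" for n
    unfolding D_def using finite_index_subgroup_Int[OF P] assms(3) by blast
  have genD: "generate D T = carrier D"
    unfolding D_def using generate_consistent[OF TP P] by (simp add: P_def)
  interpret D: subgroup_chain D "\<lambda>n. P \<inter> K n" T
  proof (intro subgroup_chain.intro subgroup_chain_axioms.intro)
    show "subgroup (P \<inter> K n) D" for n using index[of n] by (simp add: finite_index_subgroup_def)
    then show "finite (lcosets\<^bsub>D\<^esub> (P \<inter> K n))" for n
      using index[of n] group.finite_lcosets[OF D] by (simp add: finite_index_subgroup_def)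
    show "decseq (\<lambda>n. P \<inter> K n)" using assms(4) unfolding decseq_def by blast
  qed (use D TP finT genD in \<open>auto simp: D_def\<close>)
  have act: "t <#\<^bsub>D\<^esub> Y = t <#\<^bsub>G\<^esub> Y" for t Y by (simp add: D_def)
  have transfer: "(\<Sum>X\<in>lcosets\<^bsub>G\<^esub> (K n). if X \<inter> P = {} then 0 else v (X \<inter> P)) = (\<Sum>Y\<in>D.X n. v Y)"
    for n and v :: "'a set \<Rightarrow> real"
    unfolding D_def by (rule sum_lcosets_Int[OF P K Kl])
  have "(SUP n. rho_plus (schreier_graph D (P \<inter> K n) T)) < 1"
  proof (rule ccontr)
    assume not: "\<not> (SUP n. rho_plus (schreier_graph D (P \<inter> K n) T)) < 1"
    have "T \<noteq> {}" by (simp add: T_def)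
    \<comment> \<open>The concentration \<open>\<kappa>/2\<close> is chosen to lie strictly below
      what \<open>mean\<close> permits.\<close>
    then have "\<exists>n \<phi>. D.almost_invariant n \<epsilon> (\<kappa>/2) \<phi>"
      using D.nontrivial_eigenvalue_near_one[OF _ not] \<epsilon> \<kappa>
      by (intro D.almost_invariant_concentrated) auto
    then obtain n \<phi> where \<phi>: "D.almost_invariant n \<epsilon> (\<kappa>/2) \<phi>" by blast
    define N where "N = real (card (lcosets\<^bsub>G\<^esub> (K n)))"
    define m where "m = real (card (D.X n))"
    have m: "m > 0" using D.fin[of n] D.X_nonempty[of n] by (simp add: m_def card_gt_0_iff)
    have mN: "m \<le> N"
    proof -
      have "card (D.X n) = card {X \<in> lcosets\<^bsub>G\<^esub> (K n). X \<inter> P \<noteq> {}}"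
        using bij_betw_same_card[OF lcosets_Int_bij[OF P K]] by (simp add: D_def)
      also have "\<dots> \<le> card (lcosets\<^bsub>G\<^esub> (K n))" using Kl by (intro card_mono) auto
      finally show ?thesis by (simp add: m_def N_def)
    qed
    have sq: "(\<Sum>Y\<in>D.X n. (\<phi> Y)\<^sup>2) = m" and abs: "(\<Sum>Y\<in>D.X n. \<bar>\<phi> Y\<bar>) = m * avg (D.X n) \<phi>"
      using \<phi> m by (auto simp: D.almost_invariant_def avg_def m_def divide_eq_eq)
    \<comment> \<open>Extension by zero to G/K n. Displacements do not grow, since \<open>P\<close>
      preserves both the orbit and its complement.\<close>
    define \<Phi> where "\<Phi> X = (if X \<inter> P = {} then 0 else \<phi> (X \<inter> P))" for X
    have "(\<Sum>X\<in>lcosets\<^bsub>G\<^esub> (K n). (\<Phi> X)\<^sup>2) = (\<Sum>X\<in>lcosets\<^bsub>G\<^esub> (K n). if X \<inter> P = {} then 0 else (\<phi> (X \<inter> P))\<^sup>2)"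
      by (intro sum.cong refl) (simp add: \<Phi>_def)
    also have "\<dots> = m" unfolding transfer[where v = "\<lambda>Y. (\<phi> Y)\<^sup>2"] by (rule sq)
    finally have \<Phi>2: "(\<Sum>X\<in>lcosets\<^bsub>G\<^esub> (K n). (\<Phi> X)\<^sup>2) = m" .
    have "(\<Sum>X\<in>lcosets\<^bsub>G\<^esub> (K n). \<bar>\<Phi> X\<bar>) = (\<Sum>X\<in>lcosets\<^bsub>G\<^esub> (K n). if X \<inter> P = {} then 0 else \<bar>\<phi> (X \<inter> P)\<bar>)"
      by (intro sum.cong refl) (simp add: \<Phi>_def)
    also have "\<dots> = m * avg (D.X n) \<phi>" unfolding transfer[where v = "\<lambda>Y. \<bar>\<phi> Y\<bar>"] by (rule abs)
    finally have \<Phi>1: "(\<Sum>X\<in>lcosets\<^bsub>G\<^esub> (K n). \<bar>\<Phi> X\<bar>) = m * avg (D.X n) \<phi>" .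
    have "(\<Sum>X\<in>lcosets\<^bsub>G\<^esub> (K n). (\<Phi> (t <#\<^bsub>G\<^esub> X) - \<Phi> X)\<^sup>2) \<le> \<epsilon> * (\<Sum>X\<in>lcosets\<^bsub>G\<^esub> (K n). (\<Phi> X)\<^sup>2)"
      if t: "t \<in> T0" for t
    proof -
      have tT: "t \<in> T" and tP: "t \<in> P" using t TP by (auto simp: T_def)
      have "(\<Sum>X\<in>lcosets\<^bsub>G\<^esub> (K n). (\<Phi> (t <#\<^bsub>G\<^esub> X) - \<Phi> X)\<^sup>2)
          = (\<Sum>X\<in>lcosets\<^bsub>G\<^esub> (K n). if X \<inter> P = {} then 0 else (\<phi> (t <#\<^bsub>G\<^esub> (X \<inter> P)) - \<phi> (X \<inter> P))\<^sup>2)"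
      proof (intro sum.cong refl)
        fix X assume X: "X \<in> lcosets\<^bsub>G\<^esub> (K n)"
        have "(t <#\<^bsub>G\<^esub> X) \<inter> P = t <#\<^bsub>G\<^esub> (X \<inter> P)"
          by (rule l_coset_Int[OF P tP lcosets_subset[OF K X]])
        moreover have "t <#\<^bsub>G\<^esub> (X \<inter> P) = {} \<longleftrightarrow> X \<inter> P = {}" by (auto simp: l_coset_def)
        ultimately show "(\<Phi> (t <#\<^bsub>G\<^esub> X) - \<Phi> X)\<^sup>2
            = (if X \<inter> P = {} then 0 else (\<phi> (t <#\<^bsub>G\<^esub> (X \<inter> P)) - \<phi> (X \<inter> P))\<^sup>2)"
          by (simp add: \<Phi>_def)
      qed
      also have "\<dots> = (\<Sum>Y\<in>D.X n. (\<phi> (t <#\<^bsub>G\<^esub> Y) - \<phi> Y)\<^sup>2)"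
        by (rule transfer[where v = "\<lambda>Y. (\<phi> (t <#\<^bsub>G\<^esub> Y) - \<phi> Y)\<^sup>2"])
      also have "\<dots> = m * avg (D.X n) (\<lambda>Y. (\<phi> (t <#\<^bsub>D\<^esub> Y) - \<phi> Y)\<^sup>2)"
        using m by (simp add: avg_def m_def act)
      also have "\<dots> \<le> m * \<epsilon>"
        using \<phi> tT m by (intro mult_left_mono) (auto simp: D.almost_invariant_def)
      finally show ?thesis by (simp add: \<Phi>2 mult.commute)
    qed
    \<comment> \<open>Spreading over all \<open>N\<close> cosets is harder than over the
      \<open>m\<close> cosets of the orbit: as \<open>m \<le> N\<close>, the lower bound with
      \<kappa> contradicts the concentration \<open>\<kappa>/2\<close> inside the orbit.\<close>
    from mean[OF this] have "\<kappa> * N * m \<le> (m * avg (D.X n) \<phi>)\<^sup>2"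
      unfolding \<Phi>1 \<Phi>2 N_def[symmetric] .
    also have "\<dots> = m\<^sup>2 * (avg (D.X n) \<phi>)\<^sup>2" by (simp add: power_mult_distrib)
    also have "\<dots> \<le> m\<^sup>2 * (\<kappa>/2)"
      using \<phi> by (intro mult_left_mono) (auto simp: D.almost_invariant_def)
    also have "\<dots> < m\<^sup>2 * \<kappa>" using m \<kappa> by (intro mult_strict_left_mono) auto
    also have "\<dots> = \<kappa> * m * m" by (simp add: power2_eq_square)
    also have "\<dots> \<le> \<kappa> * N * m" using mN m \<kappa> by (intro mult_right_mono mult_left_mono) auto
    finally show False by simp
  qed
  moreover have "symmetric_generating_set T D"
  proof -
    have invD: "inv\<^bsub>D\<^esub> t = inv\<^bsub>G\<^esub> t" if "t \<in> T" for t
      unfolding D_def using m_inv_consistent[OF P] that TP by blast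
    have T0c: "t \<in> carrier G" if "t \<in> T0" for t using that TG by (auto simp: T_def)
    have "set_inv\<^bsub>D\<^esub> T = (\<lambda>t. inv\<^bsub>G\<^esub> t) ` T" using invD by (auto simp: SET_INV_def)
    also have "\<dots> = T"
      unfolding T_def image_insert image_Un image_image using T0c by auto
    finally show ?thesis
      unfolding symmetric_generating_set_def using finT TP genD by (simp add: D_def)
  qed
  ultimately have tau: "property_tau D (\<lambda>n. P \<inter> K n)"
    unfolding property_tau_def using index by blast
  have fg: "finitely_generated_subgroup P G"
    unfolding finitely_generated_subgroup_def using P finT TP P_def by blast
  obtain M :: nat where M: "1 / \<kappa> < real M" using reals_Archimedean2 by blast
  then have M0: "M > 0" using \<kappa> by (metis of_nat_0 gr0I not_less zero_less_divide_1_iff less_imp_le)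
  have "finite (rcosets\<^bsub>G\<^esub> (P <#>\<^bsub>G\<^esub> K n)) \<and> card (rcosets\<^bsub>G\<^esub> (P <#>\<^bsub>G\<^esub> K n)) < M"
    if normal: "K n \<lhd> G" for n
  proof -
    have "finite (rcosets\<^bsub>G\<^esub> (P <#>\<^bsub>G\<^esub> K n)) \<and> \<kappa> * real (card (rcosets\<^bsub>G\<^esub> (P <#>\<^bsub>G\<^esub> K n))) \<le> 1"
    proof (rule card_rcosets_mult_le[OF P normal Kl \<kappa>])
      fix A assume A: "A \<subseteq> lcosets\<^bsub>G\<^esub> (K n)" "A \<noteq> {}"
        and inv: "\<And>t X. t \<in> P \<Longrightarrow> X \<in> lcosets\<^bsub>G\<^esub> (K n) \<Longrightarrow> t <#\<^bsub>G\<^esub> X \<in> A \<longleftrightarrow> X \<in> A"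
      \<comment> \<open>The indicator of a P-invariant set is exactly invariant, and its L1 norm and
        squared L2 norm are both \<open>card A\<close>, so \<open>mean\<close> bounds the density of
        \<open>A\<close> from below by \<kappa>.\<close>
      define \<phi> where "\<phi> X = (if X \<in> A then 1 else 0 :: real)" for X
      have finA: "finite A" using A(1) Kl finite_subset by blast
      have total: "(\<Sum>X\<in>lcosets\<^bsub>G\<^esub> (K n). \<phi> X) = real (card A)"
        using A(1) Kl by (simp add: \<phi>_def sum.If_cases Int_absorb1)
      have pw: "(\<phi> X)\<^sup>2 = \<phi> X" "\<bar>\<phi> X\<bar> = \<phi> X" for X by (simp_all add: \<phi>_def)
      have "(\<Sum>X\<in>lcosets\<^bsub>G\<^esub> (K n). (\<phi> (t <#\<^bsub>G\<^esub> X) - \<phi> X)\<^sup>2) \<le> \<epsilon> * (\<Sum>X\<in>lcosets\<^bsub>G\<^esub> (K n). (\<phi> X)\<^sup>2)"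
        if "t \<in> T0" for t
      proof -
        have "t \<in> P" using that TP by (auto simp: T_def)
        then have "(\<Sum>X\<in>lcosets\<^bsub>G\<^esub> (K n). (\<phi> (t <#\<^bsub>G\<^esub> X) - \<phi> X)\<^sup>2) = 0"
          using inv by (intro sum.neutral) (simp add: \<phi>_def)
        then show ?thesis using \<epsilon> by (simp add: sum_nonneg)
      qed
      from mean[OF this] have "\<kappa> * real (card (lcosets\<^bsub>G\<^esub> (K n))) * real (card A) \<le> real (card A) * real (card A)"
        by (simp only: pw total power2_eq_square[of "real (card A)"])
      moreover have "real (card A) > 0" using A(2) finA by (simp add: card_gt_0_iff)
      ultimately show "\<kappa> * real (card (lcosets\<^bsub>G\<^esub> (K n))) \<le> real (card A)"
        by (simp only: mult_le_cancel_right_pos)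
    qed
    then have fin: "finite (rcosets\<^bsub>G\<^esub> (P <#>\<^bsub>G\<^esub> K n))"
      and "real (card (rcosets\<^bsub>G\<^esub> (P <#>\<^bsub>G\<^esub> K n))) \<le> 1 / \<kappa>"
      using \<kappa> by (simp_all add: field_simps)
    then show ?thesis using M by linarith
  qed
  then show ?thesis using fg PH tau M0 unfolding D_def by blast
qed

end
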